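(* Suppose that for each $j\in\{1,\dots,J\}$ we have $\boldsymbol f_{1,j},\boldsymbol f_{2,j}\in L^\infty(0,T;\boldsymbol H^{-1}(\Omega))$ and $\boldsymbol v_{j,h}^0,\boldsymbol w_{j,h}^0\in \boldsymbol V_h\subset \boldsymbol H^1(\Omega)$. Let $\Delta t=T/M>0$ be any time-step ($M\ge 1$ an integer), let $\alpha_j>0$ for $j=1,\dots,J$, and let $\mu>\tfrac12$. Then the solutions $(\boldsymbol v_{j,h}^{n},\boldsymbol w_{j,h}^{n})$, $0\le n\le M$, of the fully discrete ensemble scheme described in the context satisfy, for every $j=1,\dots,J$, $$ \|\boldsymbol v_{j,h}^M\|^2+\|\boldsymbol w_{j,h}^M\|^2+\frac{\bar\nu+\bar\nu_m}{2}\Delta t\left(\|\nabla \boldsymbol v_{j,h}^{M}\|^2+\|\nabla \boldsymbol w_{j,h}^{M}\|^2\right)+\frac{\alpha_j\Delta t}{2}\sum_{n=0}^{M-1}\left(\|\nabla \boldsymbol v_{j,h}^n\|^2+\|\nabla \boldsymbol w_{j,h}^n\|^2\right) $$ $$ \le\|\boldsymbol v_{j,h}^0\|^2+\|\boldsymbol w_{j,h}^0\|^2+\frac{\bar\nu+\bar\nu_m}{2}\Delta t\left(\|\nabla \boldsymbol v_{j,h}^{0}\|^2+\|\nabla \boldsymbol w_{j,h}^{0}\|^2\right)+\frac{2\Delta t}{\alpha_j}\sum_{n=0}^{M-1}\left(\|\boldsymbol f_{1,j}(t^{n+1})\|_{-1}^2+\|\boldsymbol f_{2,j}(t^{n+1})\|_{-1}^2\right).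 $$
   Context: Domain and spaces. $\Omega\subset\mathbb R^d$, $d\in\{2,3\}$, is a convex polygonal or polyhedral domain; $\|\cdot\|$ and $(\cdot,\cdot)$ are the $L^2(\Omega)$ norm and inner product (scalar, vector or tensor valued); $\boldsymbol H^k(\Omega)=(H^k(\Omega))^d$, $\boldsymbol X=\boldsymbol H^1_0(\Omega)=(H_0^1(\Omega))^d$, $Q=L^2_0(\Omega)$ (mean-zero $L^2$ functions). $\boldsymbol H^{-1}(\Omega)$ is the dual of $\boldsymbol X$, with norm $\|\boldsymbol f\|_{-1}=\sup_{0\ne\boldsymbol\chi\in\boldsymbol X}(\boldsymbol f,\boldsymbol\chi)/\|\nabla\boldsymbol\chi\|$, where $(\boldsymbol f,\boldsymbol\chi)$ also denotes the duality pairing. The trilinear form is $b(\boldsymbol u,\boldsymbol v,\boldsymbol w)=(\boldsymbol u\cdot\nabla\boldsymbol v,\boldsymbol w)$. Finite elements. $(\boldsymbol X_h,Q_h)\subset \boldsymbol X\times Q$ is the conforming Scott-Vogelius pair $((P_k)^d,P_{k-1}^{disc})$ on a regular triangulation of $\Omega$ with maximal element diameter $h$ (continuous piecewise polynomials of degree $k$ for the velocity-type variables, discontinuous piecewise polynomials of degree $k-1$ for pressures), with mesh and degree such that the discrete inf-sup condition holds (e.g. barycenter refined mesh and $k\ge d$). $\boldsymbol V_h=\{\boldsymbol v_h\in\boldsymbol X_h:(\nabla\cdot\boldsymbol v_h,q_h)=0\ \forall q_h\in Q_h\}$; since $\nabla\cdot\boldsymbol X_h\subset Q_h$, functions in $\boldsymbol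 V_h$ are pointwise divergence-free. Data. $J\ge1$ is the number of ensemble members. For $j=1,\dots,J$, $\nu_j>0$ is the kinematic viscosity, $\nu_{m,j}>0$ the magnetic diffusivity; $\bar\nu=\frac1J\sum_{j}\nu_j$, $\bar\nu_m=\frac1J\sum_j\nu_{m,j}$, $\nu_j'=\nu_j-\bar\nu$, $\nu_{m,j}'=\nu_{m,j}-\bar\nu_m$, and $$\alpha_j=\bar\nu+\bar\nu_m-|\nu_j-\nu_{m,j}|-|\nu_j'+\nu_{m,j}'| .$$ $\boldsymbol f_{1,j},\boldsymbol f_{2,j}$ are given forcings (whose values at the times $t^{n}$ are well-defined elements of $\boldsymbol H^{-1}(\Omega)$). $T>0$ is the end time, $\Delta t=T/M$, $t^n=n\Delta t$, and $\mu$ is a real tuning parameter. Ensemble notation. For a family $\boldsymbol z_j^n$, $j=1,\dots,J$: $\langle \boldsymbol z\rangle^n=\frac1J\sum_{j=1}^J\boldsymbol z_j^n$, $\boldsymbol z_j'^n=\boldsymbol z_j^n-\langle \boldsymbol z\rangle^n$. The eddy viscosity is $\nu_T(\boldsymbol z',t^n)=\mu\,\Delta t\,(l_z^n)^2$, where $l_z^n(\boldsymbol x)=\max_{1\le j\le J}|\boldsymbol z_j'^n(\boldsymbol x)|$ is a scalar function and $|\cdot|$ is the Euclidean length. These are applied to the discrete families $\boldsymbol v_{j,h}^n$ and $\boldsymbol w_{j,h}^n$, giving $\langle\boldsymbol v_h\rangle^n$, $\boldsymbol v_{j,h}'^n$, $\nu_T(\boldsymbol v_h',t^n)$, and similarly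 for $\boldsymbol w$. Scheme. Given $\boldsymbol v_{j,h}^0,\boldsymbol w_{j,h}^0\in\boldsymbol V_h$ for $j=1,\dots,J$, for $n=0,1,\dots,M-1$ and every $j$: find $\boldsymbol v_{j,h}^{n+1}\in\boldsymbol V_h$ such that for all $\boldsymbol\chi\in\boldsymbol V_h$ $$\left(\tfrac{\boldsymbol v_{j,h}^{n+1}-\boldsymbol v_{j,h}^n}{\Delta t},\boldsymbol\chi\right)+b(\langle\boldsymbol w_h\rangle^n,\boldsymbol v_{j,h}^{n+1},\boldsymbol\chi)+\tfrac{\bar\nu+\bar\nu_m}{2}(\nabla\boldsymbol v_{j,h}^{n+1},\nabla\boldsymbol\chi)+(2\nu_T(\boldsymbol w_h',t^n)\nabla\boldsymbol v_{j,h}^{n+1},\nabla\boldsymbol\chi)$$ $$=(\boldsymbol f_{1,j}(t^{n+1}),\boldsymbol\chi)-b(\boldsymbol w_{j,h}'^n,\boldsymbol v_{j,h}^n,\boldsymbol\chi)-\tfrac{\nu_j-\nu_{m,j}}{2}(\nabla\boldsymbol w_{j,h}^n,\nabla\boldsymbol\chi)-\tfrac{\nu_j'+\nu_{m,j}'}{2}(\nabla\boldsymbol v_{j,h}^n,\nabla\boldsymbol\chi),$$ and find $\boldsymbol w_{j,h}^{n+1}\in\boldsymbol V_h$ such that for all $\boldsymbol l\in\boldsymbol V_h$ $$\left(\tfrac{\boldsymbol w_{j,h}^{n+1}-\boldsymbol w_{j,h}^n}{\Delta t},\boldsymbol l\right)+b(\langle\boldsymbol v_h\rangle^n,\boldsymbol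 w_{j,h}^{n+1},\boldsymbol l)+\tfrac{\bar\nu+\bar\nu_m}{2}(\nabla\boldsymbol w_{j,h}^{n+1},\nabla\boldsymbol l)+(2\nu_T(\boldsymbol v_h',t^n)\nabla\boldsymbol w_{j,h}^{n+1},\nabla\boldsymbol l)$$ $$=(\boldsymbol f_{2,j}(t^{n+1}),\boldsymbol l)-b(\boldsymbol v_{j,h}'^n,\boldsymbol w_{j,h}^n,\boldsymbol l)-\tfrac{\nu_j-\nu_{m,j}}{2}(\nabla\boldsymbol v_{j,h}^n,\nabla\boldsymbol l)-\tfrac{\nu_j'+\nu_{m,j}'}{2}(\nabla\boldsymbol w_{j,h}^n,\nabla\boldsymbol l).$$ *)

theory Defs
  imports "HOL-Analysis.Analysis"
begin

section \<open>Lebesgue and Sobolev spaces\<close>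

text \<open>
  Elements of function spaces over \<open>\<Omega>\<close> are represented by functions on the whole space; only their
  values on \<open>\<Omega>\<close> matter, and two functions that agree almost everywhere on \<open>\<Omega>\<close> represent the same
  element.  The norm and inner product of \<open>real^'n^'n\<close> are those of Frobenius, so the following three
  notions serve scalar, vector and tensor valued functions alike.
\<close>

definition L2 :: "(real^'n) set \<Rightarrow> (real^'n \<Rightarrow> 'b::euclidean_space) \<Rightarrow> bool" where
  "L2 \<Omega> f \<longleftrightarrow> f \<in> borel_measurable (lebesgue_on \<Omega>) \<and>
     integrable (lebesgue_on \<Omega>) (\<lambda>x. (norm (f x))\<^sup>2)"

definition L2_inner :: "(real^'n) set \<Rightarrow> (real^'n \<Rightarrow> 'b::euclidean_space) \<Rightarrow> (real^'n \<Rightarrow> 'b) \<Rightarrow> real" where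
  "L2_inner \<Omega> f g = integral\<^sup>L (lebesgue_on \<Omega>) (\<lambda>x. f x \<bullet> g x)"

definition L2_norm :: "(real^'n) set \<Rightarrow> (real^'n \<Rightarrow> 'b::euclidean_space) \<Rightarrow> real" where
  "L2_norm \<Omega> f = sqrt (L2_inner \<Omega> f f)"

definition ae_zero :: "(real^'n) set \<Rightarrow> (real^'n \<Rightarrow> 'b::euclidean_space) \<Rightarrow> bool" where
  "ae_zero \<Omega> f \<longleftrightarrow> (AE x in lebesgue_on \<Omega>. f x = 0)"

definition partial_deriv :: "'n::finite \<Rightarrow> (real^'n \<Rightarrow> real) \<Rightarrow> real^'n \<Rightarrow> real" where
  "partial_deriv i f x = frechet_derivative f (at x) (axis i 1)"

primrec C_k :: "nat \<Rightarrow> (real^'n \<Rightarrow> real) \<Rightarrow> bool" where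
  "C_k 0 f \<longleftrightarrow> continuous_on UNIV f"
| "C_k (Suc m) f \<longleftrightarrow> f differentiable_on UNIV \<and> (\<forall>i. C_k m (partial_deriv i f))"

definition test_function :: "(real^'n) set \<Rightarrow> (real^'n \<Rightarrow> real) \<Rightarrow> bool" where
  "test_function \<Omega> \<phi> \<longleftrightarrow> (\<forall>m. C_k m \<phi>) \<and>
     compact (closure {x. \<phi> x \<noteq> 0}) \<and> closure {x. \<phi> x \<noteq> 0} \<subseteq> \<Omega>"

definition weak_gradient :: "(real^'n) set \<Rightarrow> (real^'n \<Rightarrow> real^'n) \<Rightarrow> (real^'n \<Rightarrow> real^'n^'n) \<Rightarrow> bool" where
  "weak_gradient \<Omega> v G \<longleftrightarrow> (\<forall>\<phi> i j. test_function \<Omega> \<phi> \<longrightarrow>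
     integral\<^sup>L (lebesgue_on \<Omega>) (\<lambda>x. v x $ i * partial_deriv j \<phi> x) =
     - integral\<^sup>L (lebesgue_on \<Omega>) (\<lambda>x. G x $ i $ j * \<phi> x))"

definition H1 :: "(real^'n) set \<Rightarrow> (real^'n \<Rightarrow> real^'n) set" where
  "H1 \<Omega> = {v. L2 \<Omega> v \<and> (\<exists>G. L2 \<Omega> G \<and> weak_gradient \<Omega> v G)}"

text \<open>
  The weak gradient is determined only up to a null set, hence the choice; the entry in row \<open>i\<close> and
  column \<open>j\<close> is the derivative of the \<open>i\<close>-th component in direction \<open>j\<close>.
\<close>

definition grad :: "(real^'n) set \<Rightarrow> (real^'n \<Rightarrow> real^'n) \<Rightarrow> real^'n \<Rightarrow> real^'n^'n" where
  "grad \<Omega> v = (SOME G. L2 \<Omega> G \<and> weak_gradient \<Omega> v G)"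

definition divergence :: "(real^'n) set \<Rightarrow> (real^'n \<Rightarrow> real^'n) \<Rightarrow> real^'n \<Rightarrow> real" where
  "divergence \<Omega> v x = trace (grad \<Omega> v x)"

definition H1_norm :: "(real^'n) set \<Rightarrow> (real^'n \<Rightarrow> real^'n) \<Rightarrow> real" where
  "H1_norm \<Omega> v = sqrt ((L2_norm \<Omega> v)\<^sup>2 + (L2_norm \<Omega> (grad \<Omega> v))\<^sup>2)"

definition H10 :: "(real^'n) set \<Rightarrow> (real^'n \<Rightarrow> real^'n) set" where
  "H10 \<Omega> = {v \<in> H1 \<Omega>. \<forall>e>0. \<exists>\<phi>. (\<forall>i. test_function \<Omega> (\<lambda>x. \<phi> x $ i)) \<and>
     H1_norm \<Omega> (\<lambda>x. v x - \<phi> x) < e}"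

definition L20 :: "(real^'n) set \<Rightarrow> (real^'n \<Rightarrow> real) set" where
  "L20 \<Omega> = {q. L2 \<Omega> q \<and> integral\<^sup>L (lebesgue_on \<Omega>) q = 0}"


section \<open>The dual space\<close>

text \<open>
  As the dual norm prescribes, \<open>H10 \<Omega>\<close> carries the norm of the gradient here (equivalent to the full
  norm, by the Poincare inequality).  A functional is a total function of which only the values on
  \<open>H10 \<Omega>\<close> matter; boundedness makes it respect equality almost everywhere, and makes the supremum
  in the norm the supremum of a set that is bounded above.
\<close>

definition Hm1 :: "(real^'n) set \<Rightarrow> ((real^'n \<Rightarrow> real^'n) \<Rightarrow> real) set" where
  "Hm1 \<Omega> = {f.
     (\<forall>\<xi>\<in>H10 \<Omega>. \<forall>\<psi>\<in>H10 \<Omega>. f (\<lambda>x. \<xi> x + \<psi> x) = f \<xi> + f \<psi>) \<and>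
     (\<forall>\<xi>\<in>H10 \<Omega>. \<forall>c. f (\<lambda>x. c *\<^sub>R \<xi> x) = c * f \<xi>) \<and>
     (\<exists>C. \<forall>\<xi>\<in>H10 \<Omega>. \<bar>f \<xi>\<bar> \<le> C * L2_norm \<Omega> (grad \<Omega> \<xi>))}"

definition Hm1_norm :: "(real^'n) set \<Rightarrow> ((real^'n \<Rightarrow> real^'n) \<Rightarrow> real) \<Rightarrow> real" where
  "Hm1_norm \<Omega> f = (SUP \<xi>\<in>{\<xi>\<in>H10 \<Omega>. \<not> ae_zero \<Omega> \<xi>}. f \<xi> / L2_norm \<Omega> (grad \<Omega> \<xi>))"

text \<open>
  The Bochner space of essentially bounded, strongly measurable maps from \<open>(0, T)\<close> to \<open>Hm1 \<Omega>\<close>.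
\<close>

definition Linf_Hm1 :: "real \<Rightarrow> (real^'n) set \<Rightarrow> (real \<Rightarrow> (real^'n \<Rightarrow> real^'n) \<Rightarrow> real) \<Rightarrow> bool" where
  "Linf_Hm1 T \<Omega> f \<longleftrightarrow>
     (AE t in lebesgue_on {0<..<T}. f t \<in> Hm1 \<Omega>) \<and>
     (\<exists>s. (\<forall>n. simple_function (lebesgue_on {0<..<T}) (s n) \<and> (\<forall>t\<in>{0<..<T}. s n t \<in> Hm1 \<Omega>)) \<and>
        (AE t in lebesgue_on {0<..<T}. (\<lambda>n. Hm1_norm \<Omega> (\<lambda>\<xi>. s n t \<xi> - f t \<xi>)) \<longlonglongrightarrow> 0)) \<and>
     (\<exists>C. AE t in lebesgue_on {0<..<T}. Hm1_norm \<Omega> (f t) \<le> C)"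


section \<open>Domain, mesh and Scott--Vogelius elements\<close>

definition convex_polytopal_domain :: "(real^'n) set \<Rightarrow> bool" where
  "convex_polytopal_domain \<Omega> \<longleftrightarrow> open \<Omega> \<and> \<Omega> \<noteq> {} \<and> convex \<Omega> \<and> bounded \<Omega> \<and> polytope (closure \<Omega>)"

definition mesh :: "(real^'n) set \<Rightarrow> (real^'n) set set \<Rightarrow> bool" where
  "mesh \<Omega> \<T> \<longleftrightarrow> triangulation \<T> \<and> (\<forall>K\<in>\<T>. int CARD('n) simplex K) \<and> \<Union>\<T> = closure \<Omega>"

definition polys :: "nat \<Rightarrow> (real^'n \<Rightarrow> real) set" where
  "polys k = {p. \<exists>c :: ('n \<Rightarrow> nat) \<Rightarrow> real. \<forall>x. p x =
     (\<Sum>m | (\<Sum>i\<in>UNIV. m i) \<le> k. c m * (\<Prod>i\<in>UNIV. (x $ i) ^ m i))}"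

definition X_h :: "(real^'n) set \<Rightarrow> (real^'n) set set \<Rightarrow> nat \<Rightarrow> (real^'n \<Rightarrow> real^'n) set" where
  "X_h \<Omega> \<T> k = {v \<in> H10 \<Omega>. continuous_on (closure \<Omega>) v \<and>
     (\<forall>K\<in>\<T>. \<forall>i. \<exists>p\<in>polys k. \<forall>x\<in>K. v x $ i = p x)}"

text \<open>Discontinuous functions may take any values on the boundaries of the elements.\<close>

definition Q_h :: "(real^'n) set \<Rightarrow> (real^'n) set set \<Rightarrow> nat \<Rightarrow> (real^'n \<Rightarrow> real) set" where
  "Q_h \<Omega> \<T> k = {q \<in> L20 \<Omega>. \<forall>K\<in>\<T>. \<exists>p\<in>polys (k - 1). \<forall>x\<in>interior K. q x = p x}"

definition V_h :: "(real^'n) set \<Rightarrow> (real^'n) set set \<Rightarrow> nat \<Rightarrow> (real^'n \<Rightarrow> real^'n) set" where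
  "V_h \<Omega> \<T> k = {v \<in> X_h \<Omega> \<T> k. \<forall>q\<in>Q_h \<Omega> \<T> k. L2_inner \<Omega> (divergence \<Omega> v) q = 0}"

text \<open>Extended reals, so that a trivial velocity or pressure space needs no convention.\<close>

definition inf_sup :: "(real^'n) set \<Rightarrow> (real^'n) set set \<Rightarrow> nat \<Rightarrow> real \<Rightarrow> bool" where
  "inf_sup \<Omega> \<T> k \<beta> \<longleftrightarrow> \<beta> > 0 \<and>
     ereal \<beta> \<le> (INF q\<in>{q\<in>Q_h \<Omega> \<T> k. \<not> ae_zero \<Omega> q}. SUP v\<in>{v\<in>X_h \<Omega> \<T> k. \<not> ae_zero \<Omega> v}.
       ereal (L2_inner \<Omega> (divergence \<Omega> v) q / (L2_norm \<Omega> q * L2_norm \<Omega> (grad \<Omega> v))))"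


section \<open>The ensemble scheme\<close>

definition trilinear :: "(real^'n) set \<Rightarrow> (real^'n \<Rightarrow> real^'n) \<Rightarrow> (real^'n \<Rightarrow> real^'n) \<Rightarrow> (real^'n \<Rightarrow> real^'n) \<Rightarrow> real" where
  "trilinear \<Omega> u v w = L2_inner \<Omega> (\<lambda>x. grad \<Omega> v x *v u x) w"

definition ens_mean :: "nat \<Rightarrow> (nat \<Rightarrow> 'a::real_vector) \<Rightarrow> 'a" where
  "ens_mean J a = (1 / real J) *\<^sub>R (\<Sum>j=1..J. a j)"

definition ens_fluct :: "nat \<Rightarrow> (nat \<Rightarrow> 'a::real_vector) \<Rightarrow> nat \<Rightarrow> 'a" where
  "ens_fluct J a j = a j - ens_mean J a"

definition alpha :: "nat \<Rightarrow> (nat \<Rightarrow> real) \<Rightarrow> (nat \<Rightarrow> real) \<Rightarrow> nat \<Rightarrow> real" where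
  "alpha J \<nu> \<nu>\<^sub>m j = ens_mean J \<nu> + ens_mean J \<nu>\<^sub>m - \<bar>\<nu> j - \<nu>\<^sub>m j\<bar> - \<bar>ens_fluct J \<nu> j + ens_fluct J \<nu>\<^sub>m j\<bar>"

text \<open>The argument \<open>z\<close> is the family at the current time level, indexed by the ensemble member.\<close>

definition eddy_viscosity :: "real \<Rightarrow> real \<Rightarrow> nat \<Rightarrow> (nat \<Rightarrow> real^'n \<Rightarrow> real^'n) \<Rightarrow> real^'n \<Rightarrow> real" where
  "eddy_viscosity \<mu> \<Delta>t J z x =
     \<mu> * \<Delta>t * (Max ((\<lambda>j. norm (ens_fluct J (\<lambda>i. z i x) j)) ` {1..J}))\<^sup>2"

text \<open>
  The two equations of the scheme differ only by exchanging \<open>v\<close> and \<open>w\<close> (and the forcing).  This is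
  the one for the member \<open>j\<close> of the family \<open>v\<close>, transported by \<open>w\<close>: the families \<open>v\<close> and \<open>w\<close> are
  those of the old time level, \<open>v'\<close> is the new value of the member, and \<open>F\<close> is the forcing at
  the new time.
\<close>

definition scheme_eq ::
  "(real^'n) set \<Rightarrow> (real^'n \<Rightarrow> real^'n) set \<Rightarrow> real \<Rightarrow> real \<Rightarrow> nat \<Rightarrow> (nat \<Rightarrow> real) \<Rightarrow> (nat \<Rightarrow> real) \<Rightarrow>
   ((real^'n \<Rightarrow> real^'n) \<Rightarrow> real) \<Rightarrow> (nat \<Rightarrow> real^'n \<Rightarrow> real^'n) \<Rightarrow> (nat \<Rightarrow> real^'n \<Rightarrow> real^'n) \<Rightarrow>
   nat \<Rightarrow> (real^'n \<Rightarrow> real^'n) \<Rightarrow> bool" where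
  "scheme_eq \<Omega> V \<mu> \<Delta>t J \<nu> \<nu>\<^sub>m F v w j v' \<longleftrightarrow> (\<forall>\<xi>\<in>V.
     L2_inner \<Omega> (\<lambda>x. (1 / \<Delta>t) *\<^sub>R (v' x - v j x)) \<xi>
     + trilinear \<Omega> (\<lambda>x. ens_mean J (\<lambda>i. w i x)) v' \<xi>
     + (ens_mean J \<nu> + ens_mean J \<nu>\<^sub>m) / 2 * L2_inner \<Omega> (grad \<Omega> v') (grad \<Omega> \<xi>)
     + L2_inner \<Omega> (\<lambda>x. (2 * eddy_viscosity \<mu> \<Delta>t J w x) *\<^sub>R grad \<Omega> v' x) (grad \<Omega> \<xi>)
     = F \<xi>
     - trilinear \<Omega> (\<lambda>x. ens_fluct J (\<lambda>i. w i x) j) (v j) \<xi>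
     - (\<nu> j - \<nu>\<^sub>m j) / 2 * L2_inner \<Omega> (grad \<Omega> (w j)) (grad \<Omega> \<xi>)
     - (ens_fluct J \<nu> j + ens_fluct J \<nu>\<^sub>m j) / 2 * L2_inner \<Omega> (grad \<Omega> (v j)) (grad \<Omega> \<xi>))"

text \<open>Here \<open>v n j\<close> is the member \<open>j\<close> at the time level \<open>n\<close>.\<close>

definition ensemble_solution ::
  "(real^'n) set \<Rightarrow> (real^'n \<Rightarrow> real^'n) set \<Rightarrow> real \<Rightarrow> real \<Rightarrow> nat \<Rightarrow> nat \<Rightarrow> (nat \<Rightarrow> real) \<Rightarrow> (nat \<Rightarrow> real) \<Rightarrow>
   (nat \<Rightarrow> real \<Rightarrow> (real^'n \<Rightarrow> real^'n) \<Rightarrow> real) \<Rightarrow> (nat \<Rightarrow> real \<Rightarrow> (real^'n \<Rightarrow> real^'n) \<Rightarrow> real) \<Rightarrow>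
   (nat \<Rightarrow> nat \<Rightarrow> real^'n \<Rightarrow> real^'n) \<Rightarrow> (nat \<Rightarrow> nat \<Rightarrow> real^'n \<Rightarrow> real^'n) \<Rightarrow> bool" where
  "ensemble_solution \<Omega> V \<mu> \<Delta>t M J \<nu> \<nu>\<^sub>m f\<^sub>1 f\<^sub>2 v w \<longleftrightarrow>
     (\<forall>n<M. \<forall>j\<in>{1..J}.
        v (Suc n) j \<in> V \<and>
        scheme_eq \<Omega> V \<mu> \<Delta>t J \<nu> \<nu>\<^sub>m (f\<^sub>1 j (real (Suc n) * \<Delta>t)) (v n) (w n) j (v (Suc n) j) \<and>
        w (Suc n) j \<in> V \<and>
        scheme_eq \<Omega> V \<mu> \<Delta>t J \<nu> \<nu>\<^sub>m (f\<^sub>2 j (real (Suc n) * \<Delta>t)) (w n) (v n) j (w (Suc n) j))"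

end

theory Submission
  imports Defs
begin

text \<open>
  The estimate is an energy argument.  Testing the equation of a member \<open>j\<close> with its own new value
  \<open>v'\<close> turns the difference quotient into \<open>(\<parallel>v'\<parallel>\<^sup>2 - \<parallel>v\<parallel>\<^sup>2 + \<parallel>v' - v\<parallel>\<^sup>2) / (2 \<Delta>t)\<close>.
  The implicit convective term \<open>b(\<langle>w\<rangle>, v', v')\<close> vanishes, and the explicit one is, up to sign,
  \<open>b(w\<^sub>j', v', v' - v)\<close>, where \<open>w\<^sub>j'\<close> is the fluctuation of \<open>w\<close>.  It is at most
  \<open>\<Delta>t/2 \<parallel>(\<nabla>v') w\<^sub>j'\<parallel>\<^sup>2 + \<parallel>v' - v\<parallel>\<^sup>2 / (2 \<Delta>t)\<close>: the eddy viscosity absorbs the first summand, the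
  difference quotient the second (\<open>lagged_convection_bound\<close>, \<open>eddy_viscosity_bound\<close>).  The viscous
  cross terms, estimated by Young's inequality, leave exactly \<open>\<alpha>\<^sub>j\<close> of the viscosity, of which one half
  pays for the forcing and the other half is the dissipation in the estimate
  (\<open>energy_step_arith\<close>).  Adding the two equations and summing over the time levels
  gives the theorem.

  Both facts about the convective form rest on its skew symmetry \<open>b(u, v, w) = - b(u, w, v)\<close>
  (\<open>trilinear_skew\<close>).  For test functions it says that \<open>u\<close> is orthogonal to the gradient of
  \<open>v \<bullet> w\<close>; it passes to \<open>H10 \<Omega>\<close> by density because \<open>u\<close> is bounded.  The gradient of a weakly
  differentiable function is only a choice among its weak gradients, so every passage between a
  gradient and an approximation of it needs that weak gradients are unique almost everywhere
  (\<open>weak_gradient_unique\<close>), which comes from the fundamental lemma of the calculus of variations.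

  That the transporting fields are divergence-free is the feature of the Scott--Vogelius pair: the
  divergence of a function in \<open>V_h\<close> is itself an admissible pressure, hence orthogonal to itself
  (\<open>V_h_divergence_free\<close>).  To see that it is one, the weak gradient is identified with the classical
  one inside each element, and the mean of the divergence is seen to be zero by approximation.
\<close>

section \<open>Square integrable functions\<close>

lemma L2_inner_integrable:
  fixes f g :: "real^'n \<Rightarrow> 'b::euclidean_space"
  assumes "L2 \<Omega> f" and "L2 \<Omega> g"
  shows "integrable (lebesgue_on \<Omega>) (\<lambda>x. f x \<bullet> g x)"
proof (rule Bochner_Integration.integrable_bound)
  show "integrable (lebesgue_on \<Omega>) (\<lambda>x. (norm (f x))\<^sup>2 + (norm (g x))\<^sup>2)"
    using assms by (auto simp: L2_def)
  have [measurable]: "f \<in> borel_measurable (lebesgue_on \<Omega>)" "g \<in> borel_measurable (lebesgue_on \<Omega>)"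
    using assms by (auto simp: L2_def)
  show "(\<lambda>x. f x \<bullet> g x) \<in> borel_measurable (lebesgue_on \<Omega>)"
    by measurable
  have "norm (f x \<bullet> g x) \<le> norm ((norm (f x))\<^sup>2 + (norm (g x))\<^sup>2)" for x
  proof -
    have "\<bar>f x \<bullet> g x\<bar> \<le> norm (f x) * norm (g x)" by (rule Cauchy_Schwarz_ineq2)
    also have "\<dots> \<le> (norm (f x))\<^sup>2 + (norm (g x))\<^sup>2"
      using sum_squares_bound[of "norm (f x)" "norm (g x)"]
        mult_nonneg_nonneg[OF norm_ge_zero[of "f x"] norm_ge_zero[of "g x"]] by linarith
    finally show ?thesis by simp
  qed
  then show "AE x in lebesgue_on \<Omega>. norm (f x \<bullet> g x) \<le> norm ((norm (f x))\<^sup>2 + (norm (g x))\<^sup>2)"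
    by simp
qed

lemma L2_add:
  fixes f g :: "real^'n \<Rightarrow> 'b::euclidean_space"
  assumes "L2 \<Omega> f" and "L2 \<Omega> g"
  shows "L2 \<Omega> (\<lambda>x. f x + g x)"
proof -
  have "(norm (f x + g x))\<^sup>2 = (norm (f x))\<^sup>2 + (norm (g x))\<^sup>2 + 2 * (f x \<bullet> g x)" for x
    by (simp add: power2_norm_eq_inner inner_add_left inner_add_right inner_commute)
  then show ?thesis
    using assms L2_inner_integrable[OF assms] by (auto simp: L2_def)
qed

lemma L2_scaleR:
  fixes f :: "real^'n \<Rightarrow> 'b::euclidean_space"
  assumes "L2 \<Omega> f"
  shows "L2 \<Omega> (\<lambda>x. c *\<^sub>R f x)"
  using assms by (auto simp: L2_def power_mult_distrib)

lemma L2_diff: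
  fixes f g :: "real^'n \<Rightarrow> 'b::euclidean_space"
  assumes "L2 \<Omega> f" and "L2 \<Omega> g"
  shows "L2 \<Omega> (\<lambda>x. f x - g x)"
  using L2_add[OF assms(1) L2_scaleR[OF assms(2), of "-1"]] by simp

lemma L2_inner_commute: "L2_inner \<Omega> f g = L2_inner \<Omega> g f"
  by (simp add: L2_inner_def inner_commute)

lemma L2_inner_scaleR_left:
  "L2_inner \<Omega> (\<lambda>x. c *\<^sub>R f x) g = c * L2_inner \<Omega> f g"
  by (simp add: L2_inner_def)

lemma L2_inner_diff_left:
  assumes "L2 \<Omega> f" "L2 \<Omega> g" "L2 \<Omega> k"
  shows "L2_inner \<Omega> (\<lambda>x. f x - g x) k = L2_inner \<Omega> f k - L2_inner \<Omega> g k"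
  using assms by (simp add: L2_inner_def inner_diff_left L2_inner_integrable)

lemma L2_inner_diff_right:
  assumes "L2 \<Omega> f" "L2 \<Omega> g" "L2 \<Omega> k"
  shows "L2_inner \<Omega> k (\<lambda>x. f x - g x) = L2_inner \<Omega> k f - L2_inner \<Omega> k g"
  using L2_inner_diff_left[OF assms] by (simp add: L2_inner_commute[of _ k])

lemma L2_inner_self: "L2_inner \<Omega> f f = integral\<^sup>L (lebesgue_on \<Omega>) (\<lambda>x. (norm (f x))\<^sup>2)"
  by (simp add: L2_inner_def power2_norm_eq_inner)

lemma L2_norm_power2: "(L2_norm \<Omega> f)\<^sup>2 = L2_inner \<Omega> f f"
  by (simp add: L2_norm_def L2_inner_def)

lemma L2_norm_nonneg [simp]: "L2_norm \<Omega> f \<ge> 0"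
  by (simp add: L2_norm_def L2_inner_def)

lemma L2_inner_cong_AE:
  assumes "AE x in lebesgue_on \<Omega>. f x = f' x" "AE x in lebesgue_on \<Omega>. g x = g' x"
    and "L2 \<Omega> f" "L2 \<Omega> g" "L2 \<Omega> f'" "L2 \<Omega> g'"
  shows "L2_inner \<Omega> f g = L2_inner \<Omega> f' g'"
  unfolding L2_inner_def
  by (rule integral_cong_AE)
    (use assms L2_inner_integrable[of \<Omega>] in \<open>auto simp: borel_measurable_integrable\<close>)

lemma L2_norm_cong_AE:
  assumes "AE x in lebesgue_on \<Omega>. f x = f' x" and "L2 \<Omega> f" "L2 \<Omega> f'"
  shows "L2_norm \<Omega> f = L2_norm \<Omega> f'"
  using L2_inner_cong_AE[OF assms(1,1,2,2,3,3)] by (simp add: L2_norm_def)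

text \<open>
  The discriminant argument: the square of the norm of \<open>\<parallel>g\<parallel>\<^sup>2 f - (f, g) g\<close> is nonnegative.  This
  says nothing if \<open>\<parallel>g\<parallel> = 0\<close>; then \<open>\<parallel>f - t g\<parallel>\<^sup>2\<close> is affine in \<open>t\<close> and bounded below, hence constant.
\<close>

lemma L2_Cauchy_Schwarz:
  fixes f g :: "real^'n \<Rightarrow> 'b::euclidean_space"
  assumes f: "L2 \<Omega> f" and g: "L2 \<Omega> g"
  shows "\<bar>L2_inner \<Omega> f g\<bar> \<le> L2_norm \<Omega> f * L2_norm \<Omega> g"
proof -
  define A B c where "A = L2_inner \<Omega> f f" and "B = L2_inner \<Omega> g g" and "c = L2_inner \<Omega> f g"
  have quad: "0 \<le> s\<^sup>2 * A - 2 * s * t * c + t\<^sup>2 * B" for s t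
  proof -
    have ig: "integrable (lebesgue_on \<Omega>) (\<lambda>x. f x \<bullet> f x)" "integrable (lebesgue_on \<Omega>) (\<lambda>x. f x \<bullet> g x)"
      "integrable (lebesgue_on \<Omega>) (\<lambda>x. g x \<bullet> g x)"
      using f g L2_inner_integrable by blast+
    have "0 \<le> L2_inner \<Omega> (\<lambda>x. s *\<^sub>R f x - t *\<^sub>R g x) (\<lambda>x. s *\<^sub>R f x - t *\<^sub>R g x)"
      by (simp add: L2_inner_self)
    also have "\<dots> = integral\<^sup>L (lebesgue_on \<Omega>)
        (\<lambda>x. s\<^sup>2 * (f x \<bullet> f x) - 2 * s * t * (f x \<bullet> g x) + t\<^sup>2 * (g x \<bullet> g x))"
      unfolding L2_inner_def
      by (rule Bochner_Integration.integral_cong)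
        (simp_all add: inner_diff_left inner_diff_right inner_commute power2_eq_square algebra_simps)
    also have "\<dots> = s\<^sup>2 * A - 2 * s * t * c + t\<^sup>2 * B"
      using ig by (simp add: A_def B_def c_def L2_inner_def)
    finally show ?thesis .
  qed
  have A0: "A \<ge> 0" and B0: "B \<ge> 0" using quad[of 1 0] quad[of 0 1] by auto
  have "c\<^sup>2 \<le> A * B"
  proof (cases "B = 0")
    case True
    have "c = 0"
    proof (rule ccontr)
      assume "c \<noteq> 0"
      then show False
        using quad[of 1 "(A + 1) / (2 * c)"] True by (simp add: field_simps)
    qed
    then show ?thesis using True by simp
  next
    case False
    have "0 \<le> B * (A * B - c\<^sup>2)"
      using quad[of B c] by (simp add: power2_eq_square algebra_simps)
    then show ?thesis using False B0 by (simp add: zero_le_mult_iff)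
  qed
  then have "\<bar>c\<bar> \<le> sqrt (A * B)" by (simp add: real_le_rsqrt)
  then show ?thesis by (simp add: L2_norm_def A_def B_def c_def real_sqrt_mult)
qed

lemma tendsto_L2_inner:
  fixes f g :: "real^'n \<Rightarrow> 'b::euclidean_space"
  assumes f: "L2 \<Omega> f" "\<And>n. L2 \<Omega> (F n)" and g: "L2 \<Omega> g" "\<And>n. L2 \<Omega> (G n)"
    and limF: "(\<lambda>n. L2_norm \<Omega> (\<lambda>x. f x - F n x)) \<longlonglongrightarrow> 0"
    and limG: "(\<lambda>n. L2_norm \<Omega> (\<lambda>x. g x - G n x)) \<longlonglongrightarrow> 0"
  shows "(\<lambda>n. L2_inner \<Omega> (F n) (G n)) \<longlonglongrightarrow> L2_inner \<Omega> f g"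
proof -
  let ?f = "\<lambda>n x. f x - F n x" and ?g = "\<lambda>n x. g x - G n x"
  have zero: "(\<lambda>n. L2_inner \<Omega> (a n) (b n)) \<longlonglongrightarrow> 0"
    if "\<And>n. L2 \<Omega> (a n)" "\<And>n. L2 \<Omega> (b n)" "(\<lambda>n. L2_norm \<Omega> (a n) * L2_norm \<Omega> (b n)) \<longlonglongrightarrow> 0"
    for a b :: "nat \<Rightarrow> real^'n \<Rightarrow> 'b"
    by (rule Lim_null_comparison[OF _ that(3)]) (simp add: L2_Cauchy_Schwarz that)
  have "(\<lambda>n. L2_inner \<Omega> (?f n) (?g n)) \<longlonglongrightarrow> 0"
    using tendsto_mult[OF limF limG] f g by (intro zero) (auto intro: L2_diff)
  moreover have "(\<lambda>n. L2_inner \<Omega> (?f n) g) \<longlonglongrightarrow> 0"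
    using tendsto_mult[OF limF tendsto_const[of "L2_norm \<Omega> g"]] f g by (intro zero) (auto intro: L2_diff)
  moreover have "(\<lambda>n. L2_inner \<Omega> f (?g n)) \<longlonglongrightarrow> 0"
    using tendsto_mult[OF tendsto_const[of "L2_norm \<Omega> f"] limG] f g by (intro zero) (auto intro: L2_diff)
  ultimately have "(\<lambda>n. L2_inner \<Omega> f g - L2_inner \<Omega> (?f n) g - L2_inner \<Omega> f (?g n)
      + L2_inner \<Omega> (?f n) (?g n)) \<longlonglongrightarrow> L2_inner \<Omega> f g - 0 - 0 + 0"
    by (intro tendsto_intros)
  moreover have "L2_inner \<Omega> f g - L2_inner \<Omega> (?f n) g - L2_inner \<Omega> f (?g n)
      + L2_inner \<Omega> (?f n) (?g n) = L2_inner \<Omega> (F n) (G n)" for n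
    using f g by (simp add: L2_inner_diff_left L2_inner_diff_right L2_diff)
  ultimately show ?thesis by simp
qed

lemma L2_bounded:
  fixes f :: "real^'n \<Rightarrow> 'b::euclidean_space"
  assumes \<Omega>: "\<Omega> \<in> lmeasurable" and f: "f \<in> borel_measurable (lebesgue_on \<Omega>)"
    and bound: "\<And>x. x \<in> \<Omega> \<Longrightarrow> norm (f x) \<le> C"
  shows "L2 \<Omega> f"
proof -
  interpret finite_measure "lebesgue_on \<Omega>" using \<Omega> by (rule finite_measure_lebesgue_on)
  note [measurable] = f
  have "integrable (lebesgue_on \<Omega>) (\<lambda>x. (norm (f x))\<^sup>2)"
    by (rule integrable_const_bound[where B = "C\<^sup>2"])
      (use bound in \<open>auto intro!: AE_I2 power_mono\<close>)
  then show ?thesis using f by (simp add: L2_def)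
qed

lemma L2_integrable:
  fixes f :: "real^'n \<Rightarrow> 'b::euclidean_space"
  assumes \<Omega>: "\<Omega> \<in> lmeasurable" and f: "L2 \<Omega> f"
  shows "integrable (lebesgue_on \<Omega>) f"
proof -
  have one: "L2 \<Omega> (\<lambda>x. 1::real)" by (rule L2_bounded[OF \<Omega>, where C = 1]) auto
  have [measurable]: "f \<in> borel_measurable (lebesgue_on \<Omega>)" using f by (simp add: L2_def)
  have "L2 \<Omega> (\<lambda>x. norm (f x))" using f by (simp add: L2_def)
  from L2_inner_integrable[OF this one] show ?thesis
    by (subst integrable_norm_iff[symmetric]) auto
qed

lemma L2_dominated:
  fixes f :: "real^'n \<Rightarrow> 'b::euclidean_space" and g :: "real^'n \<Rightarrow> 'c::euclidean_space"
  assumes f: "L2 \<Omega> f" and g: "g \<in> borel_measurable (lebesgue_on \<Omega>)"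
    and bound: "\<And>x. x \<in> \<Omega> \<Longrightarrow> norm (g x) \<le> C * norm (f x)" and C: "C \<ge> 0"
  shows "L2 \<Omega> g" and "L2_norm \<Omega> g \<le> C * L2_norm \<Omega> f"
proof -
  note [measurable] = g
  have le: "(norm (g x))\<^sup>2 \<le> C\<^sup>2 * (norm (f x))\<^sup>2" if "x \<in> \<Omega>" for x
    using bound[OF that] by (metis norm_ge_zero power_mono power_mult_distrib)
  have igf: "integrable (lebesgue_on \<Omega>) (\<lambda>x. C\<^sup>2 * (norm (f x))\<^sup>2)" using f by (simp add: L2_def)
  have ig: "integrable (lebesgue_on \<Omega>) (\<lambda>x. (norm (g x))\<^sup>2)"
    by (rule Bochner_Integration.integrable_bound[OF igf]) (use le in auto)
  then show "L2 \<Omega> g" using g by (simp add: L2_def)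
  have "L2_inner \<Omega> g g \<le> C\<^sup>2 * L2_inner \<Omega> f f"
    unfolding L2_inner_self integral_mult_right_zero[symmetric]
    by (rule integral_mono[OF ig igf]) (use le in auto)
  then show "L2_norm \<Omega> g \<le> C * L2_norm \<Omega> f"
    unfolding L2_norm_def using C real_sqrt_le_mono by (fastforce simp: real_sqrt_mult)
qed

lemma L2_component:
  fixes f :: "real^'n \<Rightarrow> 'b::euclidean_space^'m"
  assumes "L2 \<Omega> f"
  shows "L2 \<Omega> (\<lambda>x. f x $ i)"
proof (rule L2_dominated(1)[OF assms, where C = 1])
  have "f \<in> borel_measurable (lebesgue_on \<Omega>)" using assms by (simp add: L2_def)
  then show "(\<lambda>x. f x $ i) \<in> borel_measurable (lebesgue_on \<Omega>)"
    by (rule measurable_compose)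
      (auto intro!: borel_measurable_continuous_onI continuous_intros)
qed (simp_all add: Finite_Cartesian_Product.norm_nth_le)

lemma norm_matrix_vector_mult_le:
  fixes A :: "real^'n^'m" and x :: "real^'n"
  shows "norm (A *v x) \<le> norm A * norm x"
proof -
  have "(norm (A *v x))\<^sup>2 = (\<Sum>i\<in>UNIV. (A $ i \<bullet> x)\<^sup>2)"
    unfolding power2_norm_eq_inner inner_vec_def[of "A *v x"]
    by (simp add: matrix_vector_mul_component power2_eq_square)
  also have "\<dots> \<le> (\<Sum>i\<in>UNIV. (norm (A $ i))\<^sup>2 * (norm x)\<^sup>2)"
    by (intro sum_mono) (simp add: Cauchy_Schwarz_ineq power2_norm_eq_inner)
  also have "\<dots> = (norm A * norm x)\<^sup>2"
    by (simp add: power2_norm_eq_inner[of A] inner_vec_def[of A] power2_norm_eq_inner power_mult_distrib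
        sum_distrib_right)
  finally show ?thesis by (rule power2_le_imp_le) simp
qed

lemma borel_measurable_matrix_vector_mult [measurable]:
  fixes G :: "'a \<Rightarrow> real^'n^'m" and u :: "'a \<Rightarrow> real^'n"
  assumes "G \<in> borel_measurable M" "u \<in> borel_measurable M"
  shows "(\<lambda>x. G x *v u x) \<in> borel_measurable M"
  by (rule borel_measurable_continuous_Pair[OF assms])
    (simp add: matrix_vector_mult_def, intro continuous_intros)

lemma L2_matrix_vector_mult:
  fixes G :: "real^'n \<Rightarrow> real^'n^'m" and u :: "real^'n \<Rightarrow> real^'n"
  assumes G: "L2 \<Omega> G" and u: "u \<in> borel_measurable (lebesgue_on \<Omega>)"
    and bound: "\<And>x. x \<in> \<Omega> \<Longrightarrow> norm (u x) \<le> C" and C: "C \<ge> 0"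
  shows "L2 \<Omega> (\<lambda>x. G x *v u x)"
    and "L2_norm \<Omega> (\<lambda>x. G x *v u x) \<le> C * L2_norm \<Omega> G"
proof -
  have [measurable]: "G \<in> borel_measurable (lebesgue_on \<Omega>)" using G by (simp add: L2_def)
  note [measurable] = u
  have le: "norm (G x *v u x) \<le> C * norm (G x)" if "x \<in> \<Omega>" for x
  proof -
    have "norm (G x *v u x) \<le> norm (G x) * norm (u x)" by (rule norm_matrix_vector_mult_le)
    also have "\<dots> \<le> C * norm (G x)" using bound[OF that] by (simp add: mult.commute mult_right_mono)
    finally show ?thesis .
  qed
  have "(\<lambda>x. G x *v u x) \<in> borel_measurable (lebesgue_on \<Omega>)" by measurable
  from L2_dominated[OF G this le C] show "L2 \<Omega> (\<lambda>x. G x *v u x)"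
    and "L2_norm \<Omega> (\<lambda>x. G x *v u x) \<le> C * L2_norm \<Omega> G" by auto
qed


section \<open>Smooth functions and test functions\<close>

lemma partial_derivI:
  assumes "(f has_derivative D) (at x)"
  shows "partial_deriv i f x = D (axis i 1)"
  using assms unfolding partial_deriv_def by (simp add: frechet_derivative_at[symmetric])

lemma C_k_differentiable: "C_k (Suc m) f \<Longrightarrow> f differentiable (at x)"
  by (simp add: differentiable_on_def)

lemma C_k_Suc_imp: "C_k (Suc m) f \<Longrightarrow> C_k m f"
  by (induction m arbitrary: f) (auto simp: differentiable_imp_continuous_on)

lemma C_k_const [simp]: "C_k m (\<lambda>x::real^'n. c)"
proof (induction m arbitrary: c)
  case (Suc m)
  have "partial_deriv i (\<lambda>x. c) = (\<lambda>x::real^'n. 0)" for i :: 'n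
    by (rule ext, subst partial_derivI[of _ "\<lambda>_. 0"]) auto
  then show ?case using Suc by simp
qed simp

lemma DERIV_along_axis:
  assumes f: "f differentiable (at (x + t *\<^sub>R axis i 1))"
  shows "((\<lambda>t. f (x + t *\<^sub>R axis i 1)) has_real_derivative partial_deriv i f (x + t *\<^sub>R axis i 1)) (at t)"
proof -
  let ?e = "axis i 1 :: real^'a" and ?D = "frechet_derivative f (at (x + t *\<^sub>R axis i 1))"
  have "(f has_derivative ?D) (at (x + t *\<^sub>R ?e))"
    using f by (simp add: frechet_derivative_works)
  moreover have "((\<lambda>t. x + t *\<^sub>R ?e) has_derivative (\<lambda>h. h *\<^sub>R ?e)) (at t)"
    using has_derivative_add[OF has_derivative_const[of x] has_derivative_scaleR_left[OF has_derivative_ident, of ?e]]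
    by simp
  from has_derivative_compose[OF this calculation]
  have d: "((\<lambda>t. f (x + t *\<^sub>R ?e)) has_derivative (\<lambda>h. ?D (h *\<^sub>R ?e))) (at t)" .
  have "linear ?D" using f by (rule linear_frechet_derivative)
  then show ?thesis
    unfolding has_field_derivative_def
    by (intro has_derivative_eq_rhs[OF d] ext) (simp add: partial_deriv_def linear_scale)
qed

lemma partial_deriv_add:
  assumes "f differentiable (at x)" "g differentiable (at x)"
  shows "partial_deriv i (\<lambda>x. f x + g x) x = partial_deriv i f x + partial_deriv i g x"
  by (subst partial_derivI[OF has_derivative_add[OF assms[THEN frechet_derivative_works[THEN iffD1]]]])
    (simp add: partial_deriv_def)

lemma partial_deriv_mult:
  assumes "f differentiable (at x)" "g differentiable (at x)"
  shows "partial_deriv i (\<lambda>x. f x * g x) x = f x * partial_deriv i g x + partial_deriv i f x * g x"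
  by (subst partial_derivI[OF has_derivative_mult[OF assms[THEN frechet_derivative_works[THEN iffD1]]]])
    (simp add: partial_deriv_def)

lemma partial_deriv_sum:
  assumes "\<And>a. a \<in> A \<Longrightarrow> f a differentiable (at x)"
  shows "partial_deriv i (\<lambda>x. \<Sum>a\<in>A. f a x) x = (\<Sum>a\<in>A. partial_deriv i (f a) x)"
  using assms by (subst partial_derivI[OF has_derivative_sum[of A f "\<lambda>a. frechet_derivative (f a) (at x)"]])
      (auto simp: frechet_derivative_works partial_deriv_def)

lemma C_k_add: "C_k m f \<Longrightarrow> C_k m g \<Longrightarrow> C_k m (\<lambda>x. f x + g x)"
proof (induction m arbitrary: f g)
  case (Suc m)
  have "partial_deriv i (\<lambda>x. f x + g x) = (\<lambda>x. partial_deriv i f x + partial_deriv i g x)" for i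
    using Suc.prems C_k_differentiable by (blast intro: partial_deriv_add)
  then show ?case using Suc by (auto intro: differentiable_on_add)
qed (auto intro: continuous_intros)

lemma C_k_mult: "C_k m f \<Longrightarrow> C_k m g \<Longrightarrow> C_k m (\<lambda>x. f x * g x)"
proof (induction m arbitrary: f g)
  case (Suc m)
  have eq: "partial_deriv i (\<lambda>x. f x * g x)
      = (\<lambda>x. f x * partial_deriv i g x + partial_deriv i f x * g x)" for i
    using Suc.prems C_k_differentiable by (blast intro: partial_deriv_mult)
  have "C_k m f" "C_k m g" using Suc.prems C_k_Suc_imp by auto
  then show ?case using Suc by (auto simp: eq intro!: differentiable_on_mult C_k_add)
qed (auto intro: continuous_intros)

lemma C_k_sum: "(\<And>a. a \<in> A \<Longrightarrow> C_k m (f a)) \<Longrightarrow> C_k m (\<lambda>x. \<Sum>a\<in>A. f a x)"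
  by (induction A rule: infinite_finite_induct) (auto intro: C_k_add)

lemma C_k_prod: "(\<And>a. a \<in> A \<Longrightarrow> C_k m (f a)) \<Longrightarrow> C_k m (\<lambda>x. \<Prod>a\<in>A. f a x)"
  by (induction A rule: infinite_finite_induct) (auto intro: C_k_mult)

lemma C_k_power: "C_k m f \<Longrightarrow> C_k m (\<lambda>x. f x ^ n)"
  by (induction n) (auto intro: C_k_mult)

lemma C_k_diff: "C_k m f \<Longrightarrow> C_k m g \<Longrightarrow> C_k m (\<lambda>x. f x - g x)"
  using C_k_add[of m f "\<lambda>x. (-1) * g x"] C_k_mult[of m "\<lambda>_. -1" g] by simp

lemma C_k_component: "C_k m (\<lambda>x::real^'n. x $ i)"
proof (cases m)
  case (Suc m')
  have d: "((\<lambda>x::real^'n. x $ i) has_derivative (\<lambda>h. h $ i)) (at x)" for x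
    by (rule bounded_linear_imp_has_derivative) (rule bounded_linear_vec_nth)
  have "partial_deriv j (\<lambda>x::real^'n. x $ i) = (\<lambda>x. axis j 1 $ i)" for j
    by (rule ext, rule partial_derivI, rule d)
  moreover have "(\<lambda>x. x $ i) differentiable_on (UNIV :: (real^'n) set)"
    using d by (auto simp: differentiable_on_def differentiable_def)
  ultimately show ?thesis by (simp add: Suc)
qed (auto intro: continuous_intros)

text \<open>
  The classical function \<open>exp (-1/t)\<close>, extended by zero to \<open>t \<le> 0\<close>, is smooth.  Allowing the powers
  \<open>t\<^sup>-\<^sup>k\<close> as factors makes the family closed under differentiation.
\<close>

definition flat :: "nat \<Rightarrow> real \<Rightarrow> real" where
  "flat k t = (if t > 0 then exp (- inverse t) * inverse t ^ k else 0)"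

lemma flat_tendsto_0: "(flat k \<longlongrightarrow> 0) (at 0)"
proof -
  have "((\<lambda>s. s ^ k / exp s) \<longlongrightarrow> (0::real)) at_top" by (rule tendsto_power_div_exp_0)
  then have "((\<lambda>t. inverse t ^ k / exp (inverse t)) \<longlongrightarrow> (0::real)) (at_right 0)"
    by (rule filterlim_compose[OF _ filterlim_inverse_at_top_right])
  then have "(flat k \<longlongrightarrow> 0) (at_right 0)"
    by (rule Lim_transform_eventually)
      (auto simp: eventually_at_filter flat_def exp_minus field_simps)
  moreover have "(flat k \<longlongrightarrow> 0) (at_left 0)"
    by (rule Lim_transform_eventually[OF tendsto_const[of 0]])
      (auto simp: eventually_at_filter flat_def)
  ultimately show ?thesis by (simp add: filterlim_at_split)
qed

lemma DERIV_flat: "(flat k has_real_derivative flat (k + 2) t - real k * flat (k + 1) t) (at t)"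
proof (cases t "0::real" rule: linorder_cases)
  case less
  have "((\<lambda>_. 0::real) has_real_derivative 0) (at t)" by simp
  then have "(flat k has_real_derivative 0) (at t)"
    by (rule has_field_derivative_transform_within[where d = "-t"]) (use less in \<open>auto simp: flat_def dist_real_def\<close>)
  then show ?thesis using less by (simp add: flat_def)
next
  case equal
  (* The difference quotient of flat k at 0 is flat (k + 1). *)
  have "((\<lambda>h. (flat k (0 + h) - flat k 0) / h) \<longlongrightarrow> 0) (at 0)"
    by (rule Lim_transform_eventually[OF flat_tendsto_0[of "Suc k"]])
      (auto simp: eventually_at_filter flat_def field_simps)
  then show ?thesis using equal by (simp add: flat_def DERIV_def)
next
  case greater
  have "((\<lambda>t. exp (- inverse t) * inverse t ^ k) has_real_derivative
      (exp (- inverse t) * (inverse t * inverse t)) * inverse t ^ k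
      + exp (- inverse t) * (real k * inverse t ^ (k - 1) * - (inverse t * inverse t))) (at t)"
    using greater by (auto intro!: derivative_eq_intros)
  also have "(exp (- inverse t) * (inverse t * inverse t)) * inverse t ^ k
      + exp (- inverse t) * (real k * inverse t ^ (k - 1) * - (inverse t * inverse t))
      = flat (k + 2) t - real k * flat (k + 1) t"
    using greater by (cases k) (auto simp: flat_def algebra_simps)
  finally have "((\<lambda>t. exp (- inverse t) * inverse t ^ k) has_real_derivative
      flat (k + 2) t - real k * flat (k + 1) t) (at t)" .
  then show ?thesis
    by (rule has_field_derivative_transform_within[where d = t]) (use greater in \<open>auto simp: flat_def dist_real_def\<close>)
qed

lemma flat_bounds: "0 \<le> flat 0 t" "flat 0 t \<le> 1" "flat 0 t \<noteq> 0 \<longleftrightarrow> t > 0"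
  by (auto simp: flat_def)

lemma C_k_flat: "C_k m (\<lambda>x::real^'n. flat k (c * x $ i + d))"
proof (induction m arbitrary: k)
  case 0
  have "continuous_on UNIV (flat k)"
    by (meson DERIV_flat DERIV_isCont continuous_at_imp_continuous_on)
  then have "continuous_on UNIV (\<lambda>x::real^'n. flat k (c * x $ i + d))"
    by (rule continuous_on_compose2) (auto intro!: continuous_intros)
  then show ?case by simp
next
  case (Suc m)
  let ?F = "\<lambda>k (x::real^'n). flat k (c * x $ i + d)"
  have D: "(?F k has_derivative
      (\<lambda>h. (c * h $ i) * (?F (k + 2) x + (- real k) * ?F (k + 1) x))) (at x)" for x
  proof -
    have "((\<lambda>x::real^'n. x $ i) has_derivative (\<lambda>h. h $ i)) (at x)"
      by (rule bounded_linear_imp_has_derivative) (rule bounded_linear_vec_nth)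
    from has_derivative_add[OF has_derivative_mult_right[OF this, of c] has_derivative_const[of d]]
    have "((\<lambda>x::real^'n. c * x $ i + d) has_derivative (\<lambda>h. c * h $ i)) (at x)" by simp
    from has_derivative_compose[OF this DERIV_flat[THEN has_field_derivative_imp_has_derivative]]
    show ?thesis by (simp add: mult.commute)
  qed
  have "partial_deriv j (?F k)
      = (\<lambda>x. (c * axis j 1 $ i) * (?F (k + 2) x + (- real k) * ?F (k + 1) x))" for j
    by (rule ext, rule partial_derivI, rule D)
  moreover have "?F k differentiable_on UNIV"
    using D by (auto simp: differentiable_on_def differentiable_def)
  ultimately show ?case
    by (simp only: C_k.simps) (intro conjI allI C_k_mult C_k_add C_k_const Suc; simp)
qed

definition bump :: "real^'n \<Rightarrow> real^'n \<Rightarrow> real^'n \<Rightarrow> real" where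
  "bump a b x = (\<Prod>i\<in>UNIV. flat 0 (1 * x $ i + - a $ i) * flat 0 ((-1) * x $ i + b $ i))"

lemma bump_bounds: "0 \<le> bump a b x" "bump a b x \<le> 1"
  unfolding bump_def by (auto intro!: prod_nonneg prod_le_1 mult_nonneg_nonneg mult_le_one simp: flat_bounds)

lemma bump_nonzero: "bump a b x \<noteq> 0 \<longleftrightarrow> x \<in> box a b"
  by (auto simp: bump_def flat_bounds mem_box_cart)

lemma C_k_bump: "C_k m (bump a b)"
  unfolding bump_def[abs_def] by (intro C_k_prod C_k_mult C_k_flat)

lemma test_functionI:
  assumes "\<And>m. C_k m \<phi>" and "{x. \<phi> x \<noteq> 0} \<subseteq> K" and "compact K" and "K \<subseteq> \<Omega>"
  shows "test_function \<Omega> \<phi>"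
proof -
  have "closure {x. \<phi> x \<noteq> 0} \<subseteq> K"
    using assms by (simp add: closure_minimal compact_imp_closed)
  moreover from this have "compact (closure {x. \<phi> x \<noteq> 0})"
    using assms(3) by (metis closed_closure compact_Int_closed inf.absorb_iff2)
  ultimately show ?thesis using assms by (auto simp: test_function_def)
qed

lemma test_function_C_k: "test_function \<Omega> \<phi> \<Longrightarrow> C_k m \<phi>"
  by (simp add: test_function_def)

lemma test_function_support:
  assumes "test_function \<Omega> \<phi>"
  obtains K where "compact K" "K \<subseteq> \<Omega>" "{x. \<phi> x \<noteq> 0} \<subseteq> K"
  using that[OF _ _ closure_subset] assms by (simp add: test_function_def)

lemma test_function_mono: "test_function \<Omega> \<phi> \<Longrightarrow> \<Omega> \<subseteq> \<Omega>' \<Longrightarrow> test_function \<Omega>' \<phi>"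
  by (auto simp: test_function_def)

lemma test_function_mult:
  assumes "test_function \<Omega> \<phi>" and "\<And>m. C_k m g"
  shows "test_function \<Omega> (\<lambda>x. g x * \<phi> x)"
proof -
  obtain K where "compact K" "K \<subseteq> \<Omega>" "{x. \<phi> x \<noteq> 0} \<subseteq> K"
    by (rule test_function_support[OF assms(1)])
  then show ?thesis
    using assms by (intro test_functionI[where K = K]) (auto intro: C_k_mult test_function_C_k)
qed

lemma test_function_sum:
  assumes "finite A" "\<And>a. a \<in> A \<Longrightarrow> test_function \<Omega> (f a)"
  shows "test_function \<Omega> (\<lambda>x. \<Sum>a\<in>A. f a x)"
proof -
  have "\<exists>K. compact K \<and> K \<subseteq> \<Omega> \<and> {x. f a x \<noteq> 0} \<subseteq> K" if "a \<in> A" for a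
    using test_function_support[OF assms(2)[OF that]] by metis
  then obtain K where K: "\<And>a. a \<in> A \<Longrightarrow> compact (K a) \<and> K a \<subseteq> \<Omega> \<and> {x. f a x \<noteq> 0} \<subseteq> K a"
    by metis
  show ?thesis
  proof (rule test_functionI[where K = "\<Union>a\<in>A. K a"])
    show "{x. (\<Sum>a\<in>A. f a x) \<noteq> 0} \<subseteq> (\<Union>a\<in>A. K a)"
    proof
      fix x assume "x \<in> {x. (\<Sum>a\<in>A. f a x) \<noteq> 0}"
      then have "(\<Sum>a\<in>A. f a x) \<noteq> 0" by simp
      then obtain a where "a \<in> A" "f a x \<noteq> 0" by (rule sum.not_neutral_contains_not_neutral)
      then show "x \<in> (\<Union>a\<in>A. K a)" using K by blast
    qed
    show "compact (\<Union>a\<in>A. K a)" using assms(1) K by (intro compact_UN) auto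
    show "(\<Union>a\<in>A. K a) \<subseteq> \<Omega>" using K by blast
    show "C_k m (\<lambda>x. \<Sum>a\<in>A. f a x)" for m
      using assms(2) by (intro C_k_sum test_function_C_k)
  qed
qed

lemma partial_deriv_outside_support:
  assumes "closed K" "{x. \<phi> x \<noteq> 0} \<subseteq> K" "x \<notin> K"
  shows "partial_deriv i \<phi> x = 0"
proof -
  have "((\<lambda>_. 0::real) has_derivative (\<lambda>_. 0)) (at x)" by simp
  then have "(\<phi> has_derivative (\<lambda>_. 0)) (at x)"
    by (rule has_derivative_transform_within_open[where s = "- K"]) (use assms in auto)
  from partial_derivI[OF this] show ?thesis by simp
qed

lemma test_function_partial:
  assumes "test_function \<Omega> \<phi>"
  shows "test_function \<Omega> (partial_deriv i \<phi>)"
proof -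
  obtain K where K: "compact K" "K \<subseteq> \<Omega>" "{x. \<phi> x \<noteq> 0} \<subseteq> K"
    by (rule test_function_support[OF assms])
  show ?thesis
  proof (rule test_functionI[OF _ _ K(1,2)])
    show "C_k m (partial_deriv i \<phi>)" for m
      using test_function_C_k[OF assms, of "Suc m"] by simp
    show "{x. partial_deriv i \<phi> x \<noteq> 0} \<subseteq> K"
      using partial_deriv_outside_support[OF compact_imp_closed[OF K(1)] K(3)] by blast
  qed
qed

lemma test_function_continuous: "test_function \<Omega> \<phi> \<Longrightarrow> continuous_on S \<phi>"
  using test_function_C_k[of \<Omega> \<phi> 0] continuous_on_subset by auto

lemma test_function_measurable: "test_function \<Omega> \<phi> \<Longrightarrow> \<phi> \<in> borel_measurable borel"
  using test_function_continuous borel_measurable_continuous_onI by blast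

lemma test_function_bounded:
  assumes "test_function \<Omega> \<phi>"
  obtains B where "\<And>x. \<bar>\<phi> x\<bar> \<le> B" "B \<ge> 0"
proof -
  obtain K where K: "compact K" "K \<subseteq> \<Omega>" "{x. \<phi> x \<noteq> 0} \<subseteq> K"
    by (rule test_function_support[OF assms])
  have "bounded (\<phi> ` K)"
    by (intro compact_imp_bounded compact_continuous_image K test_function_continuous[OF assms])
  then obtain B where "\<forall>x\<in>K. \<bar>\<phi> x\<bar> \<le> B" by (auto simp: bounded_iff)
  then have "\<bar>\<phi> x\<bar> \<le> \<bar>B\<bar>" for x
    using K(3) by (cases "\<phi> x = 0") force+
  then show ?thesis by (rule that) simp
qed

lemma integral_test_function:
  assumes "test_function \<Omega> \<phi>" "\<Omega> \<in> sets lebesgue"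
  shows "integral\<^sup>L (lebesgue_on \<Omega>) \<phi> = integral\<^sup>L lborel \<phi>"
proof -
  obtain K where K: "compact K" "K \<subseteq> \<Omega>" "{x. \<phi> x \<noteq> 0} \<subseteq> K"
    by (rule test_function_support[OF assms(1)])
  have "(\<lambda>x. if x \<in> \<Omega> then \<phi> x else 0) = \<phi>" using K(2,3) by (auto simp: fun_eq_iff)
  then have "integral\<^sup>L (lebesgue_on \<Omega>) \<phi> = integral\<^sup>L lebesgue \<phi>"
    using Lebesgue_Measure.integral_restrict_UNIV[OF assms(2), of \<phi>] by simp
  also have "\<dots> = integral\<^sup>L lborel \<phi>"
    using test_function_measurable[OF assms(1)] by (simp add: integral_completion)
  finally show ?thesis .
qed

lemma integrable_test_function:
  fixes \<phi> :: "real^'n \<Rightarrow> real"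
  assumes "test_function \<Omega> \<phi>"
  shows "integrable lborel \<phi>"
proof -
  obtain K where K: "compact K" "K \<subseteq> \<Omega>" "{x. \<phi> x \<noteq> 0} \<subseteq> K"
    by (rule test_function_support[OF assms])
  have "set_integrable lborel K \<phi>"
    unfolding set_integrable_def
    by (rule borel_integrable_compact[OF K(1) test_function_continuous[OF assms]])
  then show ?thesis
    unfolding set_integrable_def by (rule back_subst[of "integrable lborel"]) (use K in \<open>auto simp: indicator_def fun_eq_iff\<close>)
qed

text \<open>
  Translating a function does not change its integral, so the difference quotients integrate to
  zero; they converge to the derivative and are dominated, by the mean value theorem.
\<close>

lemma integral_partial_deriv_zero:
  fixes \<phi> :: "real^'n \<Rightarrow> real"
  assumes \<phi>: "test_function \<Omega> \<phi>"
  shows "integral\<^sup>L lborel (partial_deriv i \<phi>) = 0"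
proof -
  let ?e = "axis i 1 :: real^'n"
  define s where "s n = inverse (real (Suc n))" for n
  have s: "s n > 0" "s n \<le> 1" "s \<longlonglongrightarrow> 0" for n
    unfolding s_def[abs_def] by (simp, simp add: field_simps, rule LIMSEQ_inverse_real_of_nat)
  obtain K where K: "compact K" "K \<subseteq> \<Omega>" "{x. \<phi> x \<noteq> 0} \<subseteq> K"
    by (rule test_function_support[OF \<phi>])
  (* Translations by at most 1 keep the support within the ball of radius R + 1. *)
  obtain R where R: "\<forall>x\<in>K. norm x \<le> R"
    using compact_imp_bounded[OF K(1)] by (auto simp: bounded_iff)
  obtain B where B: "\<And>x. \<bar>partial_deriv i \<phi> x\<bar> \<le> B" "B \<ge> 0"
    by (rule test_function_bounded[OF test_function_partial[OF \<phi>]]) blast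
  define q where "q n x = (\<phi> (x + s n *\<^sub>R ?e) - \<phi> x) / s n" for n x
  have D: "((\<lambda>t. \<phi> (x + t *\<^sub>R ?e)) has_real_derivative partial_deriv i \<phi> (x + t *\<^sub>R ?e)) (at t)" for x t
    using C_k_differentiable[OF test_function_C_k[OF \<phi>, of "Suc 0"]] by (rule DERIV_along_axis)
  have [measurable]: "\<phi> \<in> borel_measurable borel" "partial_deriv i \<phi> \<in> borel_measurable borel"
    using \<phi> test_function_measurable test_function_partial by blast+
  have lim: "(\<lambda>n. q n x) \<longlonglongrightarrow> partial_deriv i \<phi> x" for x
  proof -
    have "((\<lambda>h. (\<phi> (x + h *\<^sub>R ?e) - \<phi> x) / h) \<longlongrightarrow> partial_deriv i \<phi> x) (at 0)"
      using D[of x 0] by (simp add: DERIV_def)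
    moreover have "filterlim s (at 0) sequentially"
      using s by (auto simp: filterlim_at intro!: always_eventually) (metis less_irrefl)
    ultimately show ?thesis unfolding q_def by (rule filterlim_compose)
  qed
  have dom: "\<bar>q n x\<bar> \<le> indicator (cball 0 (R + 1)) x * B" for n x
  proof (cases "x \<in> cball 0 (R + 1)")
    case True
    obtain z where "\<phi> (x + s n *\<^sub>R ?e) - \<phi> (x + 0 *\<^sub>R ?e) = (s n - 0) * partial_deriv i \<phi> (x + z *\<^sub>R ?e)"
      using MVT2[of 0 "s n" "\<lambda>t. \<phi> (x + t *\<^sub>R ?e)" "\<lambda>t. partial_deriv i \<phi> (x + t *\<^sub>R ?e)"] D s by blast
    then show ?thesis using B(1) s(1)[of n] True by (simp add: q_def)
  next
    case False
    then have "norm x > R + 1" by simp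
    moreover have "norm (x + s n *\<^sub>R ?e) \<ge> norm x - s n"
      using norm_diff_ineq[of x "s n *\<^sub>R ?e"] s(1)[of n] by (simp add: norm_axis_1)
    ultimately have "x \<notin> K" "x + s n *\<^sub>R ?e \<notin> K" using R s(2)[of n] by force+
    then have "\<phi> x = 0" "\<phi> (x + s n *\<^sub>R ?e) = 0" using K(3) by blast+
    then show ?thesis using False by (simp add: q_def)
  qed
  have int_q: "integral\<^sup>L lborel (q n) = 0" for n
  proof -
    have i1: "integrable lborel \<phi>" using \<phi> by (rule integrable_test_function)
    have d: "lborel = distr lborel borel ((+) (s n *\<^sub>R ?e))" by (simp add: lborel_distr_plus)
    have i2: "integrable lborel (\<lambda>x. \<phi> (s n *\<^sub>R ?e + x))"
      using i1 by (subst (asm) d) (simp add: integrable_distr_eq)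
    have "integral\<^sup>L lborel \<phi> = integral\<^sup>L lborel (\<lambda>x. \<phi> (s n *\<^sub>R ?e + x))"
      by (subst d) (simp add: integral_distr)
    then show ?thesis
      using i1 i2 by (simp add: q_def[abs_def] add.commute)
  qed
  have "(\<lambda>n. integral\<^sup>L lborel (q n)) \<longlonglongrightarrow> integral\<^sup>L lborel (partial_deriv i \<phi>)"
  proof (rule integral_dominated_convergence[where w = "\<lambda>x. indicator (cball 0 (R + 1)) x * B"])
    show "integrable lborel (\<lambda>x::real^'n. indicator (cball 0 (R + 1)) x * B)"
      using emeasure_lborel_cball_finite[of "0::real^'n" "R + 1"]
      by (intro integrable_mult_left integrable_real_indicator) auto
    show "AE x in lborel. norm (q n x) \<le> indicator (cball 0 (R + 1)) x * B" for n
      using dom[of n] by (intro AE_I2) (simp only: real_norm_def)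
    show "q n \<in> borel_measurable lborel" for n unfolding q_def[abs_def] by measurable
    show "AE x in lborel. (\<lambda>n. q n x) \<longlonglongrightarrow> partial_deriv i \<phi> x"
      using lim by (rule AE_I2)
  qed measurable
  then show ?thesis by (simp add: int_q LIMSEQ_const_iff)
qed


section \<open>Uniqueness of weak gradients\<close>

text \<open>
  The powers \<open>1 - (1 - bump)\<^sup>n\<close> of the bump over a box are test functions that tend to the indicator
  of the box.
\<close>

lemma integral_box_zero:
  fixes g :: "real^'n \<Rightarrow> real"
  assumes U: "U \<in> sets lebesgue" and g: "integrable (lebesgue_on U) g"
    and orth: "\<And>\<phi>. test_function U \<phi> \<Longrightarrow> integral\<^sup>L (lebesgue_on U) (\<lambda>x. g x * \<phi> x) = 0"
    and sub: "cbox a b \<subseteq> U"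
  shows "integral\<^sup>L (lebesgue_on U) (\<lambda>x. g x * indicator (box a b) x) = 0"
proof -
  define \<phi> where "\<phi> n x = 1 - (1 - bump a b x) ^ Suc n" for n x
  have tf: "test_function U (\<phi> n)" for n
  proof (rule test_functionI[where K = "cbox a b"])
    show "C_k m (\<phi> n)" for m
      unfolding \<phi>_def[abs_def] by (intro C_k_diff C_k_const C_k_power C_k_bump)
    show "{x. \<phi> n x \<noteq> 0} \<subseteq> cbox a b"
      using bump_nonzero[of a b] box_subset_cbox[of a b] by (force simp: \<phi>_def)
  qed (use sub in auto)
  have bnd: "\<bar>\<phi> n x\<bar> \<le> 1" for n x
  proof -
    have "0 \<le> (1 - bump a b x) ^ Suc n" "(1 - bump a b x) ^ Suc n \<le> 1"
      using bump_bounds[of a b x] by (auto intro!: zero_le_power power_le_one simp del: power_Suc)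
    then show ?thesis unfolding \<phi>_def by linarith
  qed
  have lim: "(\<lambda>n. \<phi> n x) \<longlonglongrightarrow> indicator (box a b) x" for x
  proof (cases "x \<in> box a b")
    case True
    then have "0 < bump a b x" using bump_nonzero[of a b x] bump_bounds(1)[of a b x] by linarith
    then have "(\<lambda>n. (1 - bump a b x) ^ n) \<longlonglongrightarrow> 0"
      using bump_bounds(2)[of a b x] by (intro LIMSEQ_realpow_zero) auto
    from tendsto_diff[OF tendsto_const[of 1] LIMSEQ_Suc[OF this]] show ?thesis
      using True by (simp add: \<phi>_def del: power_Suc)
  next
    case False
    then have "bump a b x = 0" using bump_nonzero by blast
    then show ?thesis using False by (simp add: \<phi>_def)
  qed
  have [measurable]: "\<phi> n \<in> borel_measurable (lebesgue_on U)" for n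
    using test_function_measurable[OF tf] by (intro measurable_restrict_space1 measurable_completion) simp
  have [measurable]: "box a b \<in> sets lebesgue" by simp
  have ind: "indicator (box a b) \<in> borel_measurable (lebesgue_on U)"
    by (intro measurable_restrict_space1) measurable
  note [measurable] = ind borel_measurable_integrable[OF g]
  have "(\<lambda>n. integral\<^sup>L (lebesgue_on U) (\<lambda>x. g x * \<phi> n x))
      \<longlonglongrightarrow> integral\<^sup>L (lebesgue_on U) (\<lambda>x. g x * indicator (box a b) x)"
  proof (rule integral_dominated_convergence[where w = "\<lambda>x. norm (g x)"])
    show "AE x in lebesgue_on U. (\<lambda>n. g x * \<phi> n x) \<longlonglongrightarrow> g x * indicator (box a b) x"
      by (intro AE_I2 tendsto_intros lim)
    show "AE x in lebesgue_on U. norm (g x * \<phi> n x) \<le> norm (g x)" for n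
      using bnd by (intro AE_I2) (simp add: abs_mult mult_left_le)
    show "integrable (lebesgue_on U) (\<lambda>x. norm (g x))" using g by simp
  qed measurable
  then show ?thesis using orth[OF tf] LIMSEQ_unique by (simp add: LIMSEQ_const_iff)
qed

text \<open>
  The sets on which the integral vanishes form a Dynkin system, and the boxes, which generate the
  Borel sets, are closed under intersection.
\<close>

lemma AE_zero_if_box_integrals_zero:
  fixes h :: "'a::euclidean_space \<Rightarrow> real"
  assumes h: "integrable lborel h" and total: "integral\<^sup>L lborel h = 0"
    and box: "\<And>a b. set_lebesgue_integral lborel (box a b) h = 0"
  shows "AE x in lborel. h x = 0"
proof (rule sigma_finite_measure.density_zero[OF sigma_finite_lborel h])
  fix A :: "'a set" assume "A \<in> sets lborel"
  have set_int: "set_integrable lborel B h" if "B \<in> sets borel" for B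
    using that h unfolding set_integrable_def by (intro integrable_mult_indicator) auto
  have "Int_stable (range (\<lambda>(a, b). box a b :: 'a set))"
    by (auto simp: Int_stable_def box_Int_box)
  moreover have "range (\<lambda>(a, b). box a b :: 'a set) \<subseteq> Pow UNIV" by auto
  moreover have "A \<in> sigma_sets UNIV (range (\<lambda>(a, b). box a b))"
    using \<open>A \<in> sets lborel\<close> by (simp add: borel_eq_box)
  ultimately show "set_lebesgue_integral lborel A h = 0"
  proof (induction rule: sigma_sets_induct_disjoint)
    case (basic A)
    then show ?case using box by auto
  next
    case empty
    then show ?case by (simp add: set_lebesgue_integral_def)
  next
    case (compl A)
    then have A: "A \<in> sets borel" by (simp add: borel_eq_box)
    have "indicator (UNIV - A) x *\<^sub>R h x = h x - indicator A x *\<^sub>R h x" for x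
      by (simp add: indicator_def)
    then have "set_lebesgue_integral lborel (UNIV - A) h
        = integral\<^sup>L lborel h - set_lebesgue_integral lborel A h"
      using set_int[OF A] h unfolding set_lebesgue_integral_def set_integrable_def by simp
    then show ?case using compl total by simp
  next
    case (union A)
    then have A: "A i \<in> sets borel" for i by (auto simp: borel_eq_box)
    have "set_lebesgue_integral lborel (\<Union>i. A i) h = (\<Sum>i. set_lebesgue_integral lborel (A i) h)"
      using A union(1) set_int by (intro lebesgue_integral_countable_add) (auto simp: disjoint_family_on_def)
    then show ?case using union by simp
  qed
qed

text \<open>
  Let \<open>g\<close> be cut off outside a closed box inside \<open>U\<close>.  Every box meets the open box in a box that
  again lies inside \<open>U\<close>, so the integrals of the truncated function over all boxes vanish.  Countably
  many closed boxes exhaust \<open>U\<close>.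
\<close>

lemma fundamental_lemma:
  fixes g :: "real^'n \<Rightarrow> real"
  assumes "open U" and g: "integrable (lebesgue_on U) g"
    and orth: "\<And>\<phi>. test_function U \<phi> \<Longrightarrow> integral\<^sup>L (lebesgue_on U) (\<lambda>x. g x * \<phi> x) = 0"
  shows "AE x in lebesgue_on U. g x = 0"
proof -
  have U: "U \<in> sets lebesgue" using \<open>open U\<close> by auto
  have cell: "AE x in lebesgue. x \<in> cbox c d \<longrightarrow> g x = 0" if cd: "cbox c d \<subseteq> U" for c d
  proof -
    (* The preceding lemma speaks of Borel functions, so h is replaced by a Borel version h'. *)
    define h where "h x = (if x \<in> U then g x * indicator (box c d) x else 0)" for x
    have "integrable (lebesgue_on U) (\<lambda>x. indicator (box c d) x *\<^sub>R g x)"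
      using cd box_subset_cbox[of c d]
      by (intro integrable_mult_indicator[OF _ g]) (auto simp: sets_restrict_space_iff U)
    then have h: "integrable lebesgue h"
      unfolding h_def[abs_def] by (subst Lebesgue_Measure.integrable_restrict_UNIV[OF U]) (simp add: mult.commute)
    then obtain h' where h': "h' \<in> borel_measurable lborel" and eq: "AE x in lborel. h x = h' x"
      using completion_ex_borel_measurable_real borel_measurable_integrable by blast
    have int_h': "integrable lborel h'"
    proof -
      have "integrable lebesgue h'"
        by (rule integrable_cong_AE_imp[OF h])
          (use h' eq in \<open>auto intro: measurable_completion AE_completion simp: eq_commute\<close>)
      then show ?thesis using h' by (simp add: integrable_completion)
    qed
    have box_int: "integral\<^sup>L lborel (\<lambda>x. indicator (box a b) x * h' x)
        = integral\<^sup>L (lebesgue_on U) (\<lambda>x. g x * indicator (box a b \<inter> box c d) x)" for a b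
    proof -
      have [measurable]: "h' \<in> borel_measurable borel" using h' by simp
      have "integral\<^sup>L lborel (\<lambda>x. indicator (box a b) x * h' x)
          = integral\<^sup>L lebesgue (\<lambda>x. indicator (box a b) x * h' x)"
        by (rule integral_completion[symmetric]) simp
      also have "\<dots> = integral\<^sup>L lebesgue (\<lambda>x. indicator (box a b) x * h x)"
      proof (rule integral_cong_AE)
        show "(\<lambda>x. indicator (box a b) x * h' x) \<in> borel_measurable lebesgue"
          by (rule measurable_completion) simp
        have [measurable]: "h \<in> borel_measurable lebesgue" "box a b \<in> sets lebesgue" using h by auto
        show "(\<lambda>x. indicator (box a b) x * h x) \<in> borel_measurable lebesgue" by measurable
        show "AE x in lebesgue. indicator (box a b) x * h' x = indicator (box a b) x * h x"
          using AE_completion[OF eq] by eventually_elim simp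
      qed
      also have "\<dots> = integral\<^sup>L lebesgue (\<lambda>x. if x \<in> U then g x * indicator (box a b \<inter> box c d) x else 0)"
        by (rule Bochner_Integration.integral_cong) (auto simp: h_def indicator_def)
      also have "\<dots> = integral\<^sup>L (lebesgue_on U) (\<lambda>x. g x * indicator (box a b \<inter> box c d) x)"
        by (rule Lebesgue_Measure.integral_restrict_UNIV[OF U])
      finally show ?thesis .
    qed
    have zero: "integral\<^sup>L lborel (\<lambda>x. indicator (box a b) x * h' x) = 0" for a b
    proof -
      obtain p q where pq: "box a b \<inter> box c d = box p q" "cbox a b \<inter> cbox c d = cbox p q"
        unfolding box_Int_box Int_interval by blast
      then have "cbox p q \<subseteq> U" using cd by blast
      from integral_box_zero[OF U g orth this] show ?thesis by (simp add: box_int pq)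
    qed
    have "AE x in lborel. h' x = 0"
    proof (rule AE_zero_if_box_integrals_zero[OF int_h'])
      show "set_lebesgue_integral lborel (box a b) h' = 0" for a b
        using zero by (simp add: set_lebesgue_integral_def)
      have "integral\<^sup>L lborel h' = integral\<^sup>L lborel (\<lambda>x. indicator (box c d) x * h' x)"
      proof (rule integral_cong_AE)
        show "AE x in lborel. h' x = indicator (box c d) x * h' x"
          using eq by eventually_elim (auto simp: h_def indicator_def split: if_splits)
      qed (use h' in auto)
      then show "integral\<^sup>L lborel h' = 0" using zero by simp
    qed
    then have "AE x in lborel. h x = 0" using eq by eventually_elim simp
    moreover have "AE x in lborel. x \<notin> cbox c d - box c d"
      using null_sets_cbox_Diff_box by (rule AE_not_in)
    ultimately have "AE x in lborel. x \<in> cbox c d \<longrightarrow> g x = 0"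
      by eventually_elim (use cd in \<open>auto simp: h_def indicator_def split: if_splits\<close>)
    then show ?thesis by (rule AE_completion)
  qed
  obtain \<D> where \<D>: "countable \<D>" "\<D> \<subseteq> Pow U" "\<And>X. X \<in> \<D> \<Longrightarrow> \<exists>a b. X = cbox a b" "\<Union>\<D> = U"
    using open_countable_Union_open_cbox[OF \<open>open U\<close>] by metis
  have "AE x in lebesgue. x \<in> X \<longrightarrow> g x = 0" if X: "X \<in> \<D>" for X
  proof -
    obtain a b where "X = cbox a b" using \<D>(3)[OF X] by (elim exE)
    moreover have "X \<subseteq> U" using \<D>(2) X by blast
    ultimately show ?thesis using cell by simp
  qed
  then have "AE x in lebesgue. \<forall>X\<in>\<D>. x \<in> X \<longrightarrow> g x = 0"
    by (subst AE_ball_countable[OF \<D>(1)]) (rule ballI)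
  then have "AE x in lebesgue. x \<in> U \<longrightarrow> g x = 0"
    by eventually_elim (use \<D>(4) in blast)
  then show ?thesis using U by (simp add: AE_restrict_space_iff)
qed

lemma L2_test_function:
  assumes "\<Omega> \<in> lmeasurable" and \<phi>: "test_function U \<phi>"
  shows "L2 \<Omega> \<phi>"
proof -
  obtain B where "\<And>x. \<bar>\<phi> x\<bar> \<le> B" by (rule test_function_bounded[OF \<phi>]) blast
  moreover have "\<phi> \<in> borel_measurable (lebesgue_on \<Omega>)"
    using test_function_measurable[OF \<phi>] by (intro measurable_restrict_space1 measurable_completion) simp
  ultimately show ?thesis using assms(1) by (intro L2_bounded[where C = B]) auto
qed

lemma L2_mult_test_integrable:
  fixes g :: "real^'n \<Rightarrow> real"
  assumes "\<Omega> \<in> lmeasurable" "L2 \<Omega> g" "test_function U \<phi>"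
  shows "integrable (lebesgue_on \<Omega>) (\<lambda>x. g x * \<phi> x)"
  using L2_inner_integrable[OF assms(2) L2_test_function[OF assms(1,3)]] by simp

text \<open>
  The fundamental lemma for a difference.  The open subset \<open>U\<close> serves for the interior of a mesh
  element: there only test functions supported in the element distinguish the polynomial that a
  finite element function equals on it.
\<close>

lemma AE_eq_on_subset_if_test_integrals_eq:
  fixes g k :: "real^'n \<Rightarrow> real"
  assumes \<Omega>: "\<Omega> \<in> lmeasurable" and U: "open U" "U \<subseteq> \<Omega>" and g: "L2 \<Omega> g" and k: "L2 \<Omega> k"
    and eq: "\<And>\<phi>. test_function U \<phi> \<Longrightarrow>
      integral\<^sup>L (lebesgue_on \<Omega>) (\<lambda>x. g x * \<phi> x) = integral\<^sup>L (lebesgue_on \<Omega>) (\<lambda>x. k x * \<phi> x)"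
  shows "AE x in lebesgue_on U. g x = k x"
proof -
  have \<Omega>': "\<Omega> \<in> sets lebesgue" using \<Omega> by (rule fmeasurableD)
  have U': "U \<in> sets lebesgue" using U(1) by auto
  have "AE x in lebesgue_on U. g x - k x = 0"
  proof (rule fundamental_lemma[OF U(1)])
    have "integrable (lebesgue_on \<Omega>) (\<lambda>x. g x - k x)"
      using g k L2_integrable[OF \<Omega>] by auto
    then have "integrable lebesgue (\<lambda>x. if x \<in> \<Omega> then g x - k x else 0)"
      by (simp add: Lebesgue_Measure.integrable_restrict_UNIV[OF \<Omega>'])
    from integrable_mult_indicator[OF U' this]
    have "integrable lebesgue (\<lambda>x. if x \<in> U then g x - k x else 0)"
      by (rule back_subst[of "integrable lebesgue"]) (use U(2) in \<open>auto simp: indicator_def fun_eq_iff\<close>)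
    then show "integrable (lebesgue_on U) (\<lambda>x. g x - k x)"
      by (simp add: Lebesgue_Measure.integrable_restrict_UNIV[OF U'])
    fix \<phi> assume \<phi>: "test_function U \<phi>"
    obtain K where K: "compact K" "K \<subseteq> U" "{x. \<phi> x \<noteq> 0} \<subseteq> K" by (rule test_function_support[OF \<phi>])
    have "integral\<^sup>L (lebesgue_on U) (\<lambda>x. (g x - k x) * \<phi> x)
        = integral\<^sup>L lebesgue (\<lambda>x. if x \<in> U then (g x - k x) * \<phi> x else 0)"
      by (rule Lebesgue_Measure.integral_restrict_UNIV[OF U', symmetric])
    also have "\<dots> = integral\<^sup>L lebesgue (\<lambda>x. if x \<in> \<Omega> then (g x - k x) * \<phi> x else 0)"
      by (rule Bochner_Integration.integral_cong) (use K U(2) in auto)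
    also have "\<dots> = integral\<^sup>L (lebesgue_on \<Omega>) (\<lambda>x. (g x - k x) * \<phi> x)"
      by (rule Lebesgue_Measure.integral_restrict_UNIV[OF \<Omega>'])
    also have "\<dots> = 0"
      using eq[OF \<phi>] L2_mult_test_integrable[OF \<Omega> g \<phi>] L2_mult_test_integrable[OF \<Omega> k \<phi>]
      by (simp add: left_diff_distrib)
    finally show "integral\<^sup>L (lebesgue_on U) (\<lambda>x. (g x - k x) * \<phi> x) = 0" .
  qed
  then show ?thesis by simp
qed

lemma weak_gradient_unique:
  assumes \<Omega>: "open \<Omega>" "bounded \<Omega>" and G: "L2 \<Omega> G" "weak_gradient \<Omega> v G"
    and H: "L2 \<Omega> H" "weak_gradient \<Omega> v H"
  shows "AE x in lebesgue_on \<Omega>. G x = H x"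
proof -
  have "AE x in lebesgue_on \<Omega>. G x $ i $ j = H x $ i $ j" for i j
  proof (rule AE_eq_on_subset_if_test_integrals_eq)
    show "\<Omega> \<in> lmeasurable" using \<Omega> by (simp add: lmeasurable_open)
    show "integral\<^sup>L (lebesgue_on \<Omega>) (\<lambda>x. G x $ i $ j * \<phi> x)
        = integral\<^sup>L (lebesgue_on \<Omega>) (\<lambda>x. H x $ i $ j * \<phi> x)" if "test_function \<Omega> \<phi>" for \<phi>
      using G(2)[unfolded weak_gradient_def, rule_format, OF that, of i j]
        H(2)[unfolded weak_gradient_def, rule_format, OF that, of i j] by simp
  qed (use \<Omega> G(1) H(1) in \<open>auto intro: L2_component\<close>)
  then have "AE x in lebesgue_on \<Omega>. \<forall>i\<in>UNIV. \<forall>j\<in>UNIV. G x $ i $ j = H x $ i $ j"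
    by (intro AE_finite_allI) auto
  then show ?thesis by eventually_elim (simp add: vec_eq_iff)
qed

lemma grad_H1:
  assumes "v \<in> H1 \<Omega>"
  shows "L2 \<Omega> (grad \<Omega> v)" and "weak_gradient \<Omega> v (grad \<Omega> v)"
proof -
  have "\<exists>G. L2 \<Omega> G \<and> weak_gradient \<Omega> v G" using assms by (simp add: H1_def)
  from someI_ex[OF this] show "L2 \<Omega> (grad \<Omega> v)" "weak_gradient \<Omega> v (grad \<Omega> v)"
    by (auto simp: grad_def)
qed

lemma H1_L2: "v \<in> H1 \<Omega> \<Longrightarrow> L2 \<Omega> v"
  by (simp add: H1_def)

text \<open>
  The gradient is chosen among the weak gradients; by uniqueness it can be replaced by any weak
  gradient that is at hand.
\<close>

lemma grad_AE_eq:
  assumes "open \<Omega>" "bounded \<Omega>" "L2 \<Omega> G" "weak_gradient \<Omega> v G"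
  shows "L2 \<Omega> (grad \<Omega> v)" and "AE x in lebesgue_on \<Omega>. grad \<Omega> v x = G x"
proof -
  have ex: "\<exists>G. L2 \<Omega> G \<and> weak_gradient \<Omega> v G" using assms by blast
  from someI_ex[OF this] have "L2 \<Omega> (grad \<Omega> v)" "weak_gradient \<Omega> v (grad \<Omega> v)"
    by (auto simp: grad_def)
  then show "L2 \<Omega> (grad \<Omega> v)" and "AE x in lebesgue_on \<Omega>. grad \<Omega> v x = G x"
    using weak_gradient_unique assms by blast+
qed

section \<open>Integration by parts and skew symmetry of the convective form\<close>

text \<open>The product of \<open>f\<close> and \<open>\<phi>\<close> is a test function, and its derivatives integrate to zero.\<close>

lemma integration_by_parts:
  assumes \<Omega>: "\<Omega> \<in> sets lebesgue" and \<phi>: "test_function \<Omega> \<phi>" and f: "\<And>m. C_k m f"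
  shows "integral\<^sup>L (lebesgue_on \<Omega>) (\<lambda>x. f x * partial_deriv j \<phi> x)
    = - integral\<^sup>L (lebesgue_on \<Omega>) (\<lambda>x. partial_deriv j f x * \<phi> x)"
proof -
  have f': "C_k m (partial_deriv j f)" for m using f[of "Suc m"] by simp
  have t1: "test_function \<Omega> (\<lambda>x. f x * partial_deriv j \<phi> x)"
    using \<phi> f by (intro test_function_mult test_function_partial)
  have t2: "test_function \<Omega> (\<lambda>x. partial_deriv j f x * \<phi> x)"
    using \<phi> f' by (intro test_function_mult)
  have "partial_deriv j (\<lambda>x. f x * \<phi> x) = (\<lambda>x. f x * partial_deriv j \<phi> x + partial_deriv j f x * \<phi> x)"
    using C_k_differentiable[OF f[of "Suc 0"]] C_k_differentiable[OF test_function_C_k[OF \<phi>, of "Suc 0"]]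
    by (intro ext partial_deriv_mult)
  with integral_partial_deriv_zero[OF test_function_mult[OF \<phi> f], of j]
  have "integral\<^sup>L lborel (\<lambda>x. f x * partial_deriv j \<phi> x)
      + integral\<^sup>L lborel (\<lambda>x. partial_deriv j f x * \<phi> x) = 0"
    using integrable_test_function[OF t1] integrable_test_function[OF t2] by simp
  then show ?thesis
    using integral_test_function[OF t1 \<Omega>] integral_test_function[OF t2 \<Omega>] by simp
qed

definition classical_gradient :: "(real^'n \<Rightarrow> real^'m) \<Rightarrow> real^'n \<Rightarrow> real^'n^'m" where
  "classical_gradient f x = (\<chi> i j. partial_deriv j (\<lambda>x. f x $ i) x)"

lemma L2_sum:
  fixes f :: "'a \<Rightarrow> real^'n \<Rightarrow> 'b::euclidean_space"
  assumes "\<And>i. i \<in> A \<Longrightarrow> L2 \<Omega> (f i)"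
  shows "L2 \<Omega> (\<lambda>x. \<Sum>i\<in>A. f i x)"
proof -
  have "L2 \<Omega> (\<lambda>x. 0 :: 'b)" by (simp add: L2_def)
  then show ?thesis using assms
    by (induction A rule: infinite_finite_induct) (auto intro: L2_add)
qed

lemma L2_vecI:
  fixes f :: "real^'n \<Rightarrow> 'b::euclidean_space^'m"
  assumes "\<And>i. L2 \<Omega> (\<lambda>x. f x $ i)"
  shows "L2 \<Omega> f"
proof -
  have "f = (\<lambda>x. \<Sum>i\<in>UNIV. axis i (f x $ i))"
    by (simp add: fun_eq_iff vec_eq_iff axis_def if_distrib cong: if_cong)
  moreover have "L2 \<Omega> (\<lambda>x. axis i (f x $ i) :: 'b^'m)" for i
  proof (rule L2_dominated(1)[OF assms[of i], where C = 1])
    have "(\<lambda>x. f x $ i) \<in> borel_measurable (lebesgue_on \<Omega>)"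
      using assms[of i] by (simp add: L2_def)
    then show "(\<lambda>x. axis i (f x $ i) :: 'b^'m) \<in> borel_measurable (lebesgue_on \<Omega>)"
      by (rule measurable_compose)
        (auto intro!: borel_measurable_continuous_onI linear_continuous_on
          simp: linear_conv_bounded_linear[symmetric] linear_iff axis_def vec_eq_iff)
    show "norm (axis i (f x $ i) :: 'b^'m) \<le> 1 * norm (f x $ i)" for x
      by (simp add: norm_vec_def L2_set_def axis_def if_distrib[of norm] if_distrib[of "\<lambda>r. r\<^sup>2"] cong: if_cong)
  qed simp
  ultimately show ?thesis using L2_sum[of UNIV \<Omega> "\<lambda>i x. axis i (f x $ i)"] by simp
qed

lemma weak_gradient_classical_gradient:
  fixes \<phi> :: "real^'n \<Rightarrow> real^'n"
  assumes \<Omega>: "\<Omega> \<in> lmeasurable" and \<phi>: "\<And>i. test_function \<Omega> (\<lambda>x. \<phi> x $ i)"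
  shows "L2 \<Omega> \<phi>" and "L2 \<Omega> (classical_gradient \<phi>)" and "weak_gradient \<Omega> \<phi> (classical_gradient \<phi>)"
proof -
  show "L2 \<Omega> \<phi>" using L2_test_function[OF \<Omega> \<phi>] by (rule L2_vecI)
  show "L2 \<Omega> (classical_gradient \<phi>)"
    using L2_test_function[OF \<Omega> test_function_partial[OF \<phi>]]
    by (intro L2_vecI) (simp add: classical_gradient_def)
  show "weak_gradient \<Omega> \<phi> (classical_gradient \<phi>)"
    unfolding weak_gradient_def classical_gradient_def
    using integration_by_parts[OF fmeasurableD[OF \<Omega>]] test_function_C_k[OF \<phi>] by simp
qed

lemma weak_gradient_diff:
  fixes v w :: "real^'n \<Rightarrow> real^'n"
  assumes \<Omega>: "\<Omega> \<in> lmeasurable" and v: "L2 \<Omega> v" "L2 \<Omega> G" "weak_gradient \<Omega> v G"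
    and w: "L2 \<Omega> w" "L2 \<Omega> H" "weak_gradient \<Omega> w H"
  shows "weak_gradient \<Omega> (\<lambda>x. v x - w x) (\<lambda>x. G x - H x)"
  unfolding weak_gradient_def
proof (intro allI impI)
  fix \<phi> and i j :: 'n assume \<phi>: "test_function \<Omega> \<phi>"
  have ig: "integrable (lebesgue_on \<Omega>) (\<lambda>x. f x $ i * partial_deriv j \<phi> x)"
    if "L2 \<Omega> f" for f
    using L2_mult_test_integrable[OF \<Omega> L2_component[OF that] test_function_partial[OF \<phi>]] .
  have ig': "integrable (lebesgue_on \<Omega>) (\<lambda>x. F x $ i $ j * \<phi> x)"
    if "L2 \<Omega> F" for F
    using L2_mult_test_integrable[OF \<Omega> L2_component[OF L2_component[OF that]] \<phi>] .
  show "integral\<^sup>L (lebesgue_on \<Omega>) (\<lambda>x. (v x - w x) $ i * partial_deriv j \<phi> x)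
      = - integral\<^sup>L (lebesgue_on \<Omega>) (\<lambda>x. (G x - H x) $ i $ j * \<phi> x)"
    using v(3) w(3) \<phi> ig[OF v(1)] ig[OF w(1)] ig'[OF v(2)] ig'[OF w(2)]
    by (simp add: weak_gradient_def left_diff_distrib)
qed

text \<open>
  By uniqueness of weak gradients, the gradient of \<open>v - \<Phi> n\<close>, which the definition of \<open>H10 \<Omega>\<close>
  controls, is the difference of the gradient of \<open>v\<close> and the classical gradient of \<open>\<Phi> n\<close>.
\<close>

lemma H10_approximation:
  assumes \<Omega>: "open \<Omega>" "bounded \<Omega>" and v: "v \<in> H10 \<Omega>"
  shows "\<exists>\<Phi>. (\<forall>n i. test_function \<Omega> (\<lambda>x. \<Phi> n x $ i))
    \<and> (\<lambda>n. L2_norm \<Omega> (\<lambda>x. v x - \<Phi> n x)) \<longlonglongrightarrow> 0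
    \<and> (\<lambda>n. L2_norm \<Omega> (\<lambda>x. grad \<Omega> v x - classical_gradient (\<Phi> n) x)) \<longlonglongrightarrow> 0"
proof -
  have lm: "\<Omega> \<in> lmeasurable" using \<Omega> by (simp add: lmeasurable_open)
  have v1: "v \<in> H1 \<Omega>" using v by (simp add: H10_def)
  have "\<exists>\<phi>. (\<forall>i. test_function \<Omega> (\<lambda>x. \<phi> x $ i)) \<and> H1_norm \<Omega> (\<lambda>x. v x - \<phi> x) < inverse (real (Suc n))" for n
    using v by (simp add: H10_def)
  then obtain \<Phi> where \<Phi>: "\<And>n i. test_function \<Omega> (\<lambda>x. \<Phi> n x $ i)"
    and lt: "\<And>n. H1_norm \<Omega> (\<lambda>x. v x - \<Phi> n x) < inverse (real (Suc n))" by metis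
  have g: "L2_norm \<Omega> (grad \<Omega> (\<lambda>x. v x - \<Phi> n x)) = L2_norm \<Omega> (\<lambda>x. grad \<Omega> v x - classical_gradient (\<Phi> n) x)" for n
  proof -
    note J = weak_gradient_classical_gradient[OF lm, of "\<Phi> n", OF \<Phi>]
    have L: "L2 \<Omega> (\<lambda>x. grad \<Omega> v x - classical_gradient (\<Phi> n) x)" using grad_H1[OF v1] J by (intro L2_diff)
    have "weak_gradient \<Omega> (\<lambda>x. v x - \<Phi> n x) (\<lambda>x. grad \<Omega> v x - classical_gradient (\<Phi> n) x)"
      by (rule weak_gradient_diff[OF lm H1_L2[OF v1] grad_H1[OF v1] J])
    from grad_AE_eq[OF \<Omega> L this] show ?thesis using L by (intro L2_norm_cong_AE)
  qed
  have a: "L2_norm \<Omega> (\<lambda>x. v x - \<Phi> n x) \<le> inverse (real (Suc n))"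
    and b: "L2_norm \<Omega> (\<lambda>x. grad \<Omega> v x - classical_gradient (\<Phi> n) x) \<le> inverse (real (Suc n))" for n
    using lt[of n] unfolding H1_norm_def g
    by (smt (verit) real_sqrt_sum_squares_ge1 real_sqrt_sum_squares_ge2 L2_norm_nonneg)+
  have "(\<lambda>n. L2_norm \<Omega> (\<lambda>x. v x - \<Phi> n x)) \<longlonglongrightarrow> 0"
    by (rule tendsto_sandwich[OF _ _ tendsto_const LIMSEQ_inverse_real_of_nat]) (use a in auto)
  moreover have "(\<lambda>n. L2_norm \<Omega> (\<lambda>x. grad \<Omega> v x - classical_gradient (\<Phi> n) x)) \<longlonglongrightarrow> 0"
    by (rule tendsto_sandwich[OF _ _ tendsto_const LIMSEQ_inverse_real_of_nat]) (use b in auto)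
  ultimately show ?thesis using \<Phi> by blast
qed

text \<open>No derivative of \<open>u\<close> occurs, so linear combinations require no statement about their gradients.\<close>

definition weakly_solenoidal :: "(real^'n) set \<Rightarrow> (real^'n \<Rightarrow> real^'n) \<Rightarrow> bool" where
  "weakly_solenoidal \<Omega> u \<longleftrightarrow> (\<forall>\<phi>. test_function \<Omega> \<phi> \<longrightarrow>
     integral\<^sup>L (lebesgue_on \<Omega>) (\<lambda>x. \<Sum>j\<in>UNIV. u x $ j * partial_deriv j \<phi> x) = 0)"

text \<open>
  For test functions \<open>\<phi>\<close> and \<open>\<psi>\<close> in place of \<open>v\<close> and \<open>w\<close>, the sum of the two forms is the integral
  of \<open>u \<bullet> \<nabla>(\<phi> \<bullet> \<psi>)\<close>, which vanishes.  Since \<open>u\<close> is bounded, both forms are continuous in the norm of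
  \<open>H1 \<Omega>\<close>, and the identity passes to the limit.
\<close>

lemma trilinear_skew:
  assumes \<Omega>: "open \<Omega>" "bounded \<Omega>" and u: "u \<in> borel_measurable (lebesgue_on \<Omega>)"
    and bound: "\<And>x. x \<in> \<Omega> \<Longrightarrow> norm (u x) \<le> C" and div: "weakly_solenoidal \<Omega> u"
    and v: "v \<in> H10 \<Omega>" and w: "w \<in> H10 \<Omega>"
  shows "trilinear \<Omega> u v w = - trilinear \<Omega> u w v"
proof -
  have lm: "\<Omega> \<in> lmeasurable" using \<Omega> by (simp add: lmeasurable_open)
  have bound': "norm (u x) \<le> \<bar>C\<bar>" if "x \<in> \<Omega>" for x using bound[OF that] by linarith
  have conv: "(\<lambda>n. L2_inner \<Omega> (\<lambda>x. classical_gradient (\<Phi> n) x *v u x) (\<Psi> n)) \<longlonglongrightarrow> trilinear \<Omega> u v w"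
    if v: "v \<in> H1 \<Omega>" and w: "w \<in> H1 \<Omega>"
      and \<Phi>: "\<And>n i. test_function \<Omega> (\<lambda>x. \<Phi> n x $ i)" and \<Psi>: "\<And>n i. test_function \<Omega> (\<lambda>x. \<Psi> n x $ i)"
      and lim\<Phi>: "(\<lambda>n. L2_norm \<Omega> (\<lambda>x. grad \<Omega> v x - classical_gradient (\<Phi> n) x)) \<longlonglongrightarrow> 0"
      and lim\<Psi>: "(\<lambda>n. L2_norm \<Omega> (\<lambda>x. w x - \<Psi> n x)) \<longlonglongrightarrow> 0" for v w \<Phi> \<Psi>
    unfolding trilinear_def
  proof (rule tendsto_L2_inner)
    note Lv = grad_H1(1)[OF v]
    note J\<Phi> = weak_gradient_classical_gradient(2)[OF lm \<Phi>]
    show "L2 \<Omega> (\<lambda>x. grad \<Omega> v x *v u x)" by (rule L2_matrix_vector_mult[OF Lv u bound']) auto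
    show "L2 \<Omega> (\<lambda>x. classical_gradient (\<Phi> n) x *v u x)" for n
      by (rule L2_matrix_vector_mult[OF J\<Phi> u bound']) auto
    show "L2 \<Omega> w" using w by (rule H1_L2)
    show "L2 \<Omega> (\<Psi> n)" for n by (rule weak_gradient_classical_gradient(1)[OF lm \<Psi>])
    have le: "L2_norm \<Omega> (\<lambda>x. grad \<Omega> v x *v u x - classical_gradient (\<Phi> n) x *v u x)
        \<le> \<bar>C\<bar> * L2_norm \<Omega> (\<lambda>x. grad \<Omega> v x - classical_gradient (\<Phi> n) x)" for n
      using L2_matrix_vector_mult(2)[OF L2_diff[OF Lv J\<Phi>[of n]] u bound']
      by (simp add: matrix_vector_mult_diff_rdistrib)
    show "(\<lambda>n. L2_norm \<Omega> (\<lambda>x. grad \<Omega> v x *v u x - classical_gradient (\<Phi> n) x *v u x)) \<longlonglongrightarrow> 0"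
      by (rule tendsto_sandwich[OF _ _ tendsto_const tendsto_mult_right_zero[OF lim\<Phi>, of "\<bar>C\<bar>"]])
        (use le in auto)
  qed (rule lim\<Psi>)
  obtain \<Phi> where \<Phi>: "\<forall>n i. test_function \<Omega> (\<lambda>x. \<Phi> n x $ i)"
    "(\<lambda>n. L2_norm \<Omega> (\<lambda>x. v x - \<Phi> n x)) \<longlonglongrightarrow> 0"
    "(\<lambda>n. L2_norm \<Omega> (\<lambda>x. grad \<Omega> v x - classical_gradient (\<Phi> n) x)) \<longlonglongrightarrow> 0"
    using H10_approximation[OF \<Omega> v] by (elim exE conjE)
  note \<Phi> = \<Phi>(1)[rule_format] \<Phi>(2,3)
  obtain \<Psi> where \<Psi>: "\<forall>n i. test_function \<Omega> (\<lambda>x. \<Psi> n x $ i)"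
    "(\<lambda>n. L2_norm \<Omega> (\<lambda>x. w x - \<Psi> n x)) \<longlonglongrightarrow> 0"
    "(\<lambda>n. L2_norm \<Omega> (\<lambda>x. grad \<Omega> w x - classical_gradient (\<Psi> n) x)) \<longlonglongrightarrow> 0"
    using H10_approximation[OF \<Omega> w] by (elim exE conjE)
  note \<Psi> = \<Psi>(1)[rule_format] \<Psi>(2,3)
  have vw: "v \<in> H1 \<Omega>" "w \<in> H1 \<Omega>" using v w by (auto simp: H10_def)
  have skew: "L2_inner \<Omega> (\<lambda>x. classical_gradient (\<Phi> n) x *v u x) (\<Psi> n)
      + L2_inner \<Omega> (\<lambda>x. classical_gradient (\<Psi> n) x *v u x) (\<Phi> n) = 0" for n
  proof -
    define \<theta> where "\<theta> x = (\<Sum>i\<in>UNIV. \<Phi> n x $ i * \<Psi> n x $ i)" for x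
    have \<theta>: "test_function \<Omega> \<theta>" unfolding \<theta>_def
      by (intro test_function_sum test_function_mult test_function_C_k[OF \<Phi>(1)] \<Psi>(1)) simp
    have d: "(\<lambda>x. \<Phi> n x $ i) differentiable at x" "(\<lambda>x. \<Psi> n x $ i) differentiable at x" for i x
      using C_k_differentiable test_function_C_k[OF \<Phi>(1), of "Suc 0"] test_function_C_k[OF \<Psi>(1), of "Suc 0"]
      by blast+
    have pd: "partial_deriv j \<theta> x = (\<Sum>i\<in>UNIV. \<Phi> n x $ i * partial_deriv j (\<lambda>x. \<Psi> n x $ i) x
        + partial_deriv j (\<lambda>x. \<Phi> n x $ i) x * \<Psi> n x $ i)" for j x
      unfolding \<theta>_def[abs_def]
      by (subst partial_deriv_sum) (auto intro!: differentiable_mult d simp: partial_deriv_mult d)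
    have "(classical_gradient (\<Phi> n) x *v u x) \<bullet> \<Psi> n x + (classical_gradient (\<Psi> n) x *v u x) \<bullet> \<Phi> n x
        = (\<Sum>j\<in>UNIV. u x $ j * partial_deriv j \<theta> x)" for x
    proof -
      have "(classical_gradient (\<Phi> n) x *v u x) \<bullet> \<Psi> n x + (classical_gradient (\<Psi> n) x *v u x) \<bullet> \<Phi> n x
        = (\<Sum>i\<in>UNIV. \<Sum>j\<in>UNIV. u x $ j * (\<Phi> n x $ i * partial_deriv j (\<lambda>x. \<Psi> n x $ i) x
            + partial_deriv j (\<lambda>x. \<Phi> n x $ i) x * \<Psi> n x $ i))"
        by (simp add: inner_vec_def matrix_vector_mult_def classical_gradient_def sum_distrib_left sum_distrib_right sum.distrib
            algebra_simps)
      also have "\<dots> = (\<Sum>j\<in>UNIV. u x $ j * partial_deriv j \<theta> x)"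
        by (subst sum.swap) (simp add: pd sum_distrib_left)
      finally show ?thesis .
    qed
    moreover have "integrable (lebesgue_on \<Omega>) (\<lambda>x. (classical_gradient (\<Phi> n) x *v u x) \<bullet> \<Psi> n x)"
      "integrable (lebesgue_on \<Omega>) (\<lambda>x. (classical_gradient (\<Psi> n) x *v u x) \<bullet> \<Phi> n x)"
      by (intro L2_inner_integrable L2_matrix_vector_mult(1)[OF _ u bound']
          weak_gradient_classical_gradient(1,2)[OF lm] \<Phi>(1) \<Psi>(1) abs_ge_zero; assumption)+
    ultimately have "L2_inner \<Omega> (\<lambda>x. classical_gradient (\<Phi> n) x *v u x) (\<Psi> n)
      + L2_inner \<Omega> (\<lambda>x. classical_gradient (\<Psi> n) x *v u x) (\<Phi> n)
      = integral\<^sup>L (lebesgue_on \<Omega>) (\<lambda>x. \<Sum>j\<in>UNIV. u x $ j * partial_deriv j \<theta> x)"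
      unfolding L2_inner_def by (simp flip: Bochner_Integration.integral_add)
    then show ?thesis using div \<theta> by (simp add: weakly_solenoidal_def)
  qed
  have "(\<lambda>n. L2_inner \<Omega> (\<lambda>x. classical_gradient (\<Phi> n) x *v u x) (\<Psi> n)
      + L2_inner \<Omega> (\<lambda>x. classical_gradient (\<Psi> n) x *v u x) (\<Phi> n)) \<longlonglongrightarrow> trilinear \<Omega> u v w + trilinear \<Omega> u w v"
    using \<Phi> \<Psi> vw by (intro tendsto_add conv)
  then have "trilinear \<Omega> u v w + trilinear \<Omega> u w v = 0"
    by (simp add: skew LIMSEQ_const_iff)
  then show ?thesis by linarith
qed


section \<open>Polynomials\<close>

definition monomial :: "('n \<Rightarrow> nat) \<Rightarrow> real^'n \<Rightarrow> real" where
  "monomial m x = (\<Prod>i\<in>UNIV. (x $ i) ^ m i)"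

lemma finite_exponents: "finite {m :: 'n::finite \<Rightarrow> nat. (\<Sum>i\<in>UNIV. m i) \<le> k}"
proof (rule finite_subset)
  show "{m. (\<Sum>i\<in>UNIV. m i) \<le> k} \<subseteq> PiE (UNIV :: 'n set) (\<lambda>_. {..k})"
  proof
    fix m :: "'n \<Rightarrow> nat" assume "m \<in> {m. (\<Sum>i\<in>UNIV. m i) \<le> k}"
    then have "m i \<le> k" for i
      using member_le_sum[of i UNIV m] by auto
    then show "m \<in> PiE UNIV (\<lambda>_. {..k})" by auto
  qed
qed (simp add: finite_PiE)

lemma polys_iff:
  "p \<in> polys k \<longleftrightarrow> (\<exists>c. p = (\<lambda>x. \<Sum>m | (\<Sum>i\<in>UNIV. m i) \<le> k. c m * monomial m x))"
  by (simp add: polys_def monomial_def fun_eq_iff)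

lemma C_k_monomial: "C_k n (monomial m)"
  unfolding monomial_def[abs_def] by (intro C_k_prod C_k_power C_k_component)

lemma C_k_polys: "p \<in> polys k \<Longrightarrow> C_k n p"
  unfolding polys_iff by (elim exE, simp only:) (intro C_k_sum C_k_mult C_k_const C_k_monomial)

lemma polys_add:
  assumes "p \<in> polys k" "q \<in> polys k"
  shows "(\<lambda>x. p x + q x) \<in> polys k"
proof -
  obtain c d where "p = (\<lambda>x. \<Sum>m | (\<Sum>i\<in>UNIV. m i) \<le> k. c m * monomial m x)"
    and "q = (\<lambda>x. \<Sum>m | (\<Sum>i\<in>UNIV. m i) \<le> k. d m * monomial m x)"
    using assms by (auto simp: polys_iff)
  then show ?thesis
    unfolding polys_iff by (intro exI[of _ "\<lambda>m. c m + d m"]) (simp add: distrib_right sum.distrib)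
qed

lemma polys_monomial:
  assumes "(\<Sum>i\<in>UNIV. m i) \<le> k"
  shows "(\<lambda>x. a * monomial m x) \<in> polys k"
  unfolding polys_iff
proof (intro exI ext)
  fix x :: "real^'a"
  have "(\<Sum>m' | (\<Sum>i\<in>UNIV. m' i) \<le> k. (if m' = m then a else 0) * monomial m' x)
      = (\<Sum>m' | (\<Sum>i\<in>UNIV. m' i) \<le> k. if m' = m then a * monomial m x else 0)"
    by (rule sum.cong) auto
  also have "\<dots> = a * monomial m x" using assms by (simp add: sum.delta'[OF finite_exponents] sum.delta[OF finite_exponents])
  finally show "a * monomial m x
      = (\<Sum>m' | (\<Sum>i\<in>UNIV. m' i) \<le> k. (if m' = m then a else 0) * monomial m' x)" by simp
qed

lemma polys_zero: "(\<lambda>x. 0) \<in> polys k"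
  using polys_monomial[of "\<lambda>_. 0" k 0] by simp

lemma polys_sum: "(\<And>a. a \<in> A \<Longrightarrow> p a \<in> polys k) \<Longrightarrow> (\<lambda>x. \<Sum>a\<in>A. p a x) \<in> polys k"
  by (induction A rule: infinite_finite_induct) (auto intro: polys_zero polys_add)

lemma partial_deriv_monomial:
  "partial_deriv j (\<lambda>x. c * monomial m x) x = c * real (m j) * monomial (m(j := m j - 1)) x"
proof -
  let ?f = "\<lambda>x. c * monomial m x" and ?e = "axis j 1 :: real^'a"
  let ?R = "\<Prod>i\<in>UNIV - {j}. (x $ i) ^ m i"
  have "C_k (Suc 0) ?f" by (intro C_k_mult C_k_const C_k_monomial)
  from DERIV_along_axis[OF C_k_differentiable[OF this], where x = x and t = 0 and i = j]
  have "((\<lambda>t. ?f (x + t *\<^sub>R ?e)) has_real_derivative partial_deriv j ?f x) (at 0)" by simp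
  moreover have "?f (x + t *\<^sub>R ?e) = c * ((x $ j + t) ^ m j * ?R)" for t
    unfolding monomial_def by (subst prod.remove[of _ j]) (auto intro!: prod.cong simp: axis_def)
  ultimately have "((\<lambda>t. c * ((x $ j + t) ^ m j * ?R)) has_real_derivative partial_deriv j ?f x) (at 0)"
    by simp
  moreover have "((\<lambda>t. c * ((x $ j + t) ^ m j * ?R)) has_real_derivative
      c * (real (m j) * (x $ j) ^ (m j - 1) * ?R)) (at 0)"
    by (auto intro!: derivative_eq_intros)
  ultimately have "partial_deriv j ?f x = c * (real (m j) * (x $ j) ^ (m j - 1) * ?R)"
    by (rule DERIV_unique)
  also have "\<dots> = c * real (m j) * monomial (m(j := m j - 1)) x"
    unfolding monomial_def by (subst prod.remove[of _ j]) (auto intro!: prod.cong)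
  finally show ?thesis .
qed

lemma polys_partial_deriv:
  assumes p: "p \<in> polys k" and k: "k \<ge> 1"
  shows "partial_deriv j p \<in> polys (k - 1)"
proof -
  obtain c where c: "p = (\<lambda>x. \<Sum>m | (\<Sum>i\<in>UNIV. m i) \<le> k. c m * monomial m x)"
    using p by (auto simp: polys_iff)
  have diff: "(\<lambda>x. c m * monomial m x) differentiable (at x)" for m x
    by (rule C_k_differentiable[where m = 0]) (intro C_k_mult C_k_const C_k_monomial)
  have "partial_deriv j p
      = (\<lambda>x. \<Sum>m | (\<Sum>i\<in>UNIV. m i) \<le> k. c m * real (m j) * monomial (m(j := m j - 1)) x)"
    unfolding c by (rule ext) (simp only: partial_deriv_sum[OF diff] partial_deriv_monomial)
  moreover have "(\<lambda>x. c m * real (m j) * monomial (m(j := m j - 1)) x) \<in> polys (k - 1)"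
    if m: "(\<Sum>i\<in>UNIV. m i) \<le> k" for m
  proof (cases "m j = 0")
    case True
    then show ?thesis by (simp add: polys_zero)
  next
    case False
    have "(\<Sum>i\<in>UNIV. (m(j := m j - 1)) i) = (m j - 1) + (\<Sum>i\<in>UNIV - {j}. m i)"
      by (subst sum.remove[of _ j]) (auto intro!: sum.cong)
    moreover have "(\<Sum>i\<in>UNIV. m i) = m j + (\<Sum>i\<in>UNIV - {j}. m i)"
      by (rule sum.remove) auto
    ultimately have "(\<Sum>i\<in>UNIV. (m(j := m j - 1)) i) \<le> k - 1" using m False by linarith
    then show ?thesis by (rule polys_monomial)
  qed
  ultimately show ?thesis by (auto intro: polys_sum)
qed

section \<open>Discretely divergence-free functions are divergence-free\<close>

lemma L2_continuous:
  fixes f :: "real^'n \<Rightarrow> 'b::euclidean_space"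
  assumes "open \<Omega>" "bounded \<Omega>" and f: "continuous_on UNIV f"
  shows "L2 \<Omega> f"
proof -
  have "compact (f ` closure \<Omega>)"
    using assms by (intro compact_continuous_image) (auto intro: continuous_on_subset)
  then obtain C where "\<forall>y\<in>f ` closure \<Omega>. norm y \<le> C"
    using compact_imp_bounded bounded_iff by metis
  then have "norm (f x) \<le> C" if "x \<in> \<Omega>" for x using closure_subset that by blast
  moreover have "f \<in> borel_measurable (lebesgue_on \<Omega>)"
    using borel_measurable_continuous_onI[OF f]
    by (intro measurable_restrict_space1 measurable_completion) simp
  ultimately show ?thesis
    using assms by (intro L2_bounded[where C = C]) (auto simp: lmeasurable_open)
qed

lemma L2_cong_AE:
  fixes f :: "real^'n \<Rightarrow> 'b::euclidean_space"
  assumes \<Omega>: "\<Omega> \<in> sets lebesgue" and f: "L2 \<Omega> f" and eq: "AE x in lebesgue_on \<Omega>. f x = g x"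
  shows "L2 \<Omega> g"
proof -
  have "(\<lambda>x. if x \<in> \<Omega> then f x else 0) \<in> borel_measurable lebesgue"
    using f by (intro borel_measurable_if_I \<Omega>) (simp add: L2_def)
  moreover have "AE x in lebesgue. (if x \<in> \<Omega> then f x else 0) = (if x \<in> \<Omega> then g x else 0)"
    using eq \<Omega> by (simp add: AE_restrict_space_iff)
  ultimately have "(\<lambda>x. if x \<in> \<Omega> then g x else 0) \<in> borel_measurable lebesgue"
    by (rule borel_measurable_AE)
  then have g: "g \<in> borel_measurable (lebesgue_on \<Omega>)" by (rule borel_measurable_if_D)
  note [measurable] = g
  have "integrable (lebesgue_on \<Omega>) (\<lambda>x. (norm (g x))\<^sup>2)"
    by (rule integrable_cong_AE_imp[of _ "\<lambda>x. (norm (f x))\<^sup>2"])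
      (use f eq in \<open>auto simp: L2_def elim: eventually_mono\<close>)
  then show ?thesis using g by (simp add: L2_def)
qed

lemma partial_deriv_cong_open:
  assumes "open U" "x \<in> U" "\<And>y. y \<in> U \<Longrightarrow> f y = g y" and g: "g differentiable (at x)"
  shows "partial_deriv j f x = partial_deriv j g x"
proof -
  have "(g has_derivative frechet_derivative g (at x)) (at x)"
    using g by (simp add: frechet_derivative_works)
  then have "(f has_derivative frechet_derivative g (at x)) (at x)"
    by (rule has_derivative_transform_within_open[OF _ assms(1,2)]) (simp add: assms(3))
  then show ?thesis by (subst partial_derivI) (auto simp: partial_deriv_def)
qed

text \<open>
  True of test functions, and preserved in the limit because the constant matrix with the single
  entry 1 is square integrable on the bounded set \<open>\<Omega>\<close>.
\<close>

lemma H10_integral_grad_zero: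
  assumes \<Omega>: "open \<Omega>" "bounded \<Omega>" and v: "v \<in> H10 \<Omega>"
  shows "integral\<^sup>L (lebesgue_on \<Omega>) (\<lambda>x. grad \<Omega> v x $ i $ j) = 0"
proof -
  have lm: "\<Omega> \<in> lmeasurable" using \<Omega> by (simp add: lmeasurable_open)
  obtain \<Phi> where \<Phi>: "\<forall>n i. test_function \<Omega> (\<lambda>x. \<Phi> n x $ i)"
    "(\<lambda>n. L2_norm \<Omega> (\<lambda>x. grad \<Omega> v x - classical_gradient (\<Phi> n) x)) \<longlonglongrightarrow> 0"
    using H10_approximation[OF \<Omega> v] by (elim exE conjE)
  have v1: "v \<in> H1 \<Omega>" using v by (simp add: H10_def)
  let ?E = "\<lambda>x::real^'a. axis i (axis j 1) :: real^'a^'a"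
  have E: "L2 \<Omega> ?E" by (rule L2_bounded[OF lm]) auto
  have inner: "L2_inner \<Omega> G ?E = integral\<^sup>L (lebesgue_on \<Omega>) (\<lambda>x. G x $ i $ j)" for G
    by (simp add: L2_inner_def inner_axis)
  have "(\<lambda>n. L2_inner \<Omega> (classical_gradient (\<Phi> n)) ?E) \<longlonglongrightarrow> L2_inner \<Omega> (grad \<Omega> v) ?E"
  proof (rule tendsto_L2_inner)
    show "L2 \<Omega> (classical_gradient (\<Phi> n))" for n
      using \<Phi>(1) by (intro weak_gradient_classical_gradient(2)[OF lm]) simp
    show "(\<lambda>n. L2_norm \<Omega> (\<lambda>x. ?E x - ?E x)) \<longlonglongrightarrow> 0" by (simp add: L2_norm_def L2_inner_def)
  qed (use grad_H1[OF v1] E \<Phi>(2) in auto)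
  moreover have "integral\<^sup>L (lebesgue_on \<Omega>) (\<lambda>x. classical_gradient (\<Phi> n) x $ i $ j) = 0" for n
    using integral_partial_deriv_zero[OF \<Phi>(1)[rule_format, of n i], of j]
      integral_test_function[OF test_function_partial[OF \<Phi>(1)[rule_format, of n i], of j] fmeasurableD[OF lm]]
    by (simp add: classical_gradient_def)
  ultimately show ?thesis by (simp add: inner LIMSEQ_const_iff)
qed

text \<open>
  Against test functions supported in \<open>U\<close>, the weak gradient of \<open>v\<close> acts as that of \<open>p\<close>, and \<open>p\<close> can be
  integrated by parts.
\<close>

lemma weak_gradient_on_polynomial_piece:
  assumes \<Omega>: "open \<Omega>" "bounded \<Omega>" and U: "open U" "U \<subseteq> \<Omega>" and v: "v \<in> H1 \<Omega>"
    and p: "p \<in> polys k" and eq: "\<And>x. x \<in> U \<Longrightarrow> v x $ i = p x"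
  shows "AE x in lebesgue_on U. grad \<Omega> v x $ i $ j = partial_deriv j (\<lambda>x. v x $ i) x"
proof -
  have lm: "\<Omega> \<in> lmeasurable" using \<Omega> by (simp add: lmeasurable_open)
  have C: "C_k m p" "C_k m (partial_deriv j p)" for m
    using C_k_polys[OF p, of m] C_k_polys[OF p, of "Suc m"] by auto
  have "AE x in lebesgue_on U. grad \<Omega> v x $ i $ j = partial_deriv j p x"
  proof (rule AE_eq_on_subset_if_test_integrals_eq[OF lm U])
    show "L2 \<Omega> (\<lambda>x. grad \<Omega> v x $ i $ j)" using grad_H1[OF v] by (intro L2_component)
    show "L2 \<Omega> (partial_deriv j p)" using C(2)[of 0] by (intro L2_continuous \<Omega>) simp
    fix \<phi> assume \<phi>: "test_function U \<phi>"
    obtain K where K: "compact K" "K \<subseteq> U" "{x. partial_deriv j \<phi> x \<noteq> 0} \<subseteq> K"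
      by (rule test_function_support[OF test_function_partial[OF \<phi>]])
    have \<phi>': "test_function \<Omega> \<phi>" using \<phi> U(2) by (rule test_function_mono)
    have "integral\<^sup>L (lebesgue_on \<Omega>) (\<lambda>x. grad \<Omega> v x $ i $ j * \<phi> x)
        = - integral\<^sup>L (lebesgue_on \<Omega>) (\<lambda>x. v x $ i * partial_deriv j \<phi> x)"
      using grad_H1(2)[OF v] \<phi>' by (simp add: weak_gradient_def)
    also have "(\<lambda>x. v x $ i * partial_deriv j \<phi> x) = (\<lambda>x. p x * partial_deriv j \<phi> x)"
    proof
      fix x show "v x $ i * partial_deriv j \<phi> x = p x * partial_deriv j \<phi> x"
        using K eq[of x] by (cases "partial_deriv j \<phi> x = 0") auto
    qed
    also have "- integral\<^sup>L (lebesgue_on \<Omega>) (\<lambda>x. p x * partial_deriv j \<phi> x)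
        = integral\<^sup>L (lebesgue_on \<Omega>) (\<lambda>x. partial_deriv j p x * \<phi> x)"
      using integration_by_parts[OF fmeasurableD[OF lm] \<phi>' C(1)] by simp
    finally show "integral\<^sup>L (lebesgue_on \<Omega>) (\<lambda>x. grad \<Omega> v x $ i $ j * \<phi> x)
        = integral\<^sup>L (lebesgue_on \<Omega>) (\<lambda>x. partial_deriv j p x * \<phi> x)" .
  qed
  moreover have "partial_deriv j (\<lambda>x. v x $ i) x = partial_deriv j p x" if "x \<in> U" for x
    by (rule partial_deriv_cong_open[OF U(1) that eq C_k_differentiable[OF C(1)]])
  ultimately show ?thesis by (auto elim!: lebesgue_on_mono)
qed

lemma V_h_H10: "u \<in> V_h \<Omega> \<T> k \<Longrightarrow> u \<in> H10 \<Omega>"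
  by (simp add: V_h_def X_h_def)

text \<open>
  The divergence of \<open>u\<close> is orthogonal to \<open>Q_h\<close>; if it belongs to \<open>Q_h\<close>, it is orthogonal to itself.
  Membership in \<open>Q_h\<close> asks for a polynomial at every point of the interior of an element, while the
  weak divergence is determined only almost everywhere.  Therefore its classical counterpart \<open>q\<close> is
  used as the pressure; the two agree off the boundaries of the elements, and these boundaries are
  null sets because the elements are convex.
\<close>

lemma V_h_divergence_free:
  assumes dom: "convex_polytopal_domain \<Omega>" and mesh: "mesh \<Omega> \<T>" and k: "k \<ge> 1"
    and u: "u \<in> V_h \<Omega> \<T> k"
  shows "AE x in lebesgue_on \<Omega>. divergence \<Omega> u x = 0"
proof -
  have \<Omega>: "open \<Omega>" "bounded \<Omega>" "convex \<Omega>" using dom by (auto simp: convex_polytopal_domain_def)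
  have lm: "\<Omega> \<in> lmeasurable" using \<Omega> by (simp add: lmeasurable_open)
  have \<Omega>': "\<Omega> \<in> sets lebesgue" using lm by (rule fmeasurableD)
  have u10: "u \<in> H10 \<Omega>" using u by (rule V_h_H10)
  then have u1: "u \<in> H1 \<Omega>" by (simp add: H10_def)
  have fin: "finite \<T>" and elem: "\<And>K. K \<in> \<T> \<Longrightarrow> convex K \<and> closed K" and cov: "\<Union>\<T> = closure \<Omega>"
    using mesh by (auto simp: mesh_def triangulation_def intro: convex_simplex closed_simplex)
  have sub: "interior K \<subseteq> \<Omega>" if "K \<in> \<T>" for K
  proof -
    have "interior K \<subseteq> interior (closure \<Omega>)" using cov that by (intro interior_mono) auto
    also have "\<dots> = \<Omega>" using \<Omega> by (simp add: convex_interior_closure interior_open)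
    finally show ?thesis .
  qed
  have "\<exists>p\<in>polys k. \<forall>x\<in>K. u x $ i = p x" if "K \<in> \<T>" for K i
    using u that by (auto simp: V_h_def X_h_def)
  then obtain p where p: "\<And>K i. K \<in> \<T> \<Longrightarrow> p K i \<in> polys k"
    and up: "\<And>K i x. K \<in> \<T> \<Longrightarrow> x \<in> K \<Longrightarrow> u x $ i = p K i x" by metis
  (* On the boundaries of the elements q has an arbitrary value. *)
  define q where "q x = (\<Sum>i\<in>UNIV. partial_deriv i (\<lambda>x. u x $ i) x)" for x
  have cell: "AE x in lebesgue. x \<in> interior K \<longrightarrow> divergence \<Omega> u x = q x" if K: "K \<in> \<T>" for K
  proof -
    have "AE x in lebesgue_on (interior K). grad \<Omega> u x $ i $ i = partial_deriv i (\<lambda>x. u x $ i) x" for i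
    proof (rule weak_gradient_on_polynomial_piece[OF \<Omega>(1,2) _ sub[OF K] u1 p[OF K]])
      show "u x $ i = p K i x" if "x \<in> interior K" for x
        using up[OF K] interior_subset that by blast
    qed simp
    then have "AE x in lebesgue_on (interior K). \<forall>i\<in>UNIV. grad \<Omega> u x $ i $ i = partial_deriv i (\<lambda>x. u x $ i) x"
      by (intro AE_finite_allI) auto
    then have "AE x in lebesgue_on (interior K). divergence \<Omega> u x = q x"
      by eventually_elim (simp add: divergence_def trace_def q_def)
    then show ?thesis by (subst (asm) AE_restrict_space_iff) auto
  qed
  have "AE x in lebesgue. \<forall>K\<in>\<T>. x \<in> interior K \<longrightarrow> divergence \<Omega> u x = q x"
    using fin cell by (intro AE_finite_allI)
  moreover have "AE x in lebesgue. \<forall>K\<in>\<T>. x \<notin> frontier K"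
  proof (intro AE_finite_allI[OF fin] AE_not_in)
    show "frontier K \<in> null_sets lebesgue" if "K \<in> \<T>" for K
      using elem[OF that] by (simp add: negligible_convex_frontier flip: negligible_iff_null_sets)
  qed
  ultimately have "AE x in lebesgue. x \<in> \<Omega> \<longrightarrow> divergence \<Omega> u x = q x"
  proof eventually_elim
    case (elim x)
    show ?case
    proof
      assume "x \<in> \<Omega>"
      then obtain K where K: "K \<in> \<T>" "x \<in> K" using cov closure_subset by blast
      then have "x \<in> interior K" using elim(2) elem by (auto simp: frontier_def)
      then show "divergence \<Omega> u x = q x" using elim(1) K by blast
    qed
  qed
  then have eq: "AE x in lebesgue_on \<Omega>. divergence \<Omega> u x = q x"
    using \<Omega>' by (simp add: AE_restrict_space_iff)
  have Lii: "L2 \<Omega> (\<lambda>x. grad \<Omega> u x $ i $ i)" for i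
    by (intro L2_component grad_H1(1) u1)
  have Ldiv: "L2 \<Omega> (divergence \<Omega> u)"
    unfolding divergence_def[abs_def] trace_def by (intro L2_sum Lii)
  have Lq: "L2 \<Omega> q" using L2_cong_AE[OF \<Omega>' Ldiv eq] .
  have eq': "AE x in lebesgue_on \<Omega>. q x = divergence \<Omega> u x"
    using eq by eventually_elim (rule sym)
  have "integral\<^sup>L (lebesgue_on \<Omega>) q = integral\<^sup>L (lebesgue_on \<Omega>) (divergence \<Omega> u)"
    using Lq Ldiv by (intro integral_cong_AE eq') (simp_all add: L2_def)
  also have "\<dots> = 0"
    unfolding divergence_def[abs_def] trace_def
    using L2_integrable[OF lm Lii] H10_integral_grad_zero[OF \<Omega>(1,2) u10]
    by (simp add: Bochner_Integration.integral_sum)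
  finally have "q \<in> L20 \<Omega>" using Lq by (simp add: L20_def)
  moreover have "\<exists>r\<in>polys (k - 1). \<forall>x\<in>interior K. q x = r x" if K: "K \<in> \<T>" for K
  proof (intro bexI ballI)
    show "(\<lambda>x. \<Sum>i\<in>UNIV. partial_deriv i (p K i) x) \<in> polys (k - 1)"
      using p[OF K] k by (intro polys_sum polys_partial_deriv)
    fix x assume x: "x \<in> interior K"
    have "partial_deriv i (\<lambda>x. u x $ i) x = partial_deriv i (p K i) x" for i
    proof (rule partial_deriv_cong_open[OF open_interior x])
      show "u y $ i = p K i y" if "y \<in> interior K" for y using up[OF K] interior_subset that by blast
      show "p K i differentiable (at x)"
        using C_k_differentiable[OF C_k_polys[OF p[OF K]]] .
    qed
    then show "q x = (\<Sum>i\<in>UNIV. partial_deriv i (p K i) x)" by (simp add: q_def)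
  qed
  ultimately have "q \<in> Q_h \<Omega> \<T> k" by (simp add: Q_h_def)
  then have "L2_inner \<Omega> (divergence \<Omega> u) q = 0" using u by (simp add: V_h_def)
  moreover have "L2_inner \<Omega> (divergence \<Omega> u) q = L2_inner \<Omega> (divergence \<Omega> u) (divergence \<Omega> u)"
    by (intro L2_inner_cong_AE eq' Ldiv Lq) simp
  ultimately have "integral\<^sup>L (lebesgue_on \<Omega>) (\<lambda>x. (norm (divergence \<Omega> u x))\<^sup>2) = 0"
    by (simp add: L2_inner_self)
  moreover have "integrable (lebesgue_on \<Omega>) (\<lambda>x. (norm (divergence \<Omega> u x))\<^sup>2)"
    using Ldiv by (simp add: L2_def)
  ultimately have "AE x in lebesgue_on \<Omega>. (norm (divergence \<Omega> u x))\<^sup>2 = 0"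
    by (subst (asm) integral_nonneg_eq_0_iff_AE) auto
  then show ?thesis by eventually_elim simp
qed

section \<open>Transporting fields\<close>

text \<open>
  The properties of a transporting field on which skew symmetry rests.  They pass from the members of
  an ensemble to the mean and the fluctuations.
\<close>

definition bounded_solenoidal :: "(real^'n) set \<Rightarrow> (real^'n \<Rightarrow> real^'n) \<Rightarrow> bool" where
  "bounded_solenoidal \<Omega> u \<longleftrightarrow> u \<in> borel_measurable (lebesgue_on \<Omega>) \<and>
     (\<exists>C\<ge>0. \<forall>x\<in>\<Omega>. norm (u x) \<le> C) \<and> weakly_solenoidal \<Omega> u"

lemma V_h_bounded_solenoidal:
  assumes dom: "convex_polytopal_domain \<Omega>" and mesh: "mesh \<Omega> \<T>" and k: "k \<ge> 1"
    and u: "u \<in> V_h \<Omega> \<T> k"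
  shows "bounded_solenoidal \<Omega> u"
proof -
  have \<Omega>: "open \<Omega>" "bounded \<Omega>" using dom by (auto simp: convex_polytopal_domain_def)
  have lm: "\<Omega> \<in> lmeasurable" using \<Omega> by (simp add: lmeasurable_open)
  have u1: "u \<in> H1 \<Omega>" using V_h_H10[OF u] by (simp add: H10_def)
  have "compact (u ` closure \<Omega>)"
    using u \<Omega> by (intro compact_continuous_image) (auto simp: V_h_def X_h_def)
  then obtain C where C: "\<forall>y\<in>u ` closure \<Omega>. norm y \<le> C"
    using compact_imp_bounded bounded_iff by metis
  have "\<forall>x\<in>\<Omega>. norm (u x) \<le> \<bar>C\<bar>"
  proof
    fix x assume "x \<in> \<Omega>"
    then have "norm (u x) \<le> C" using C closure_subset by blast
    then show "norm (u x) \<le> \<bar>C\<bar>" by linarith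
  qed
  then have "\<exists>C\<ge>0. \<forall>x\<in>\<Omega>. norm (u x) \<le> C" by (intro exI[of _ "\<bar>C\<bar>"]) auto
  moreover have "weakly_solenoidal \<Omega> u"
    unfolding weakly_solenoidal_def
  proof (intro allI impI)
    fix \<phi> assume \<phi>: "test_function \<Omega> \<phi>"
    have i1: "integrable (lebesgue_on \<Omega>) (\<lambda>x. u x $ j * partial_deriv j \<phi> x)" for j
      by (rule L2_mult_test_integrable[OF lm L2_component[OF H1_L2[OF u1]] test_function_partial[OF \<phi>]])
    have i2: "integrable (lebesgue_on \<Omega>) (\<lambda>x. grad \<Omega> u x $ j $ j * \<phi> x)" for j
      by (rule L2_mult_test_integrable[OF lm L2_component[OF L2_component[OF grad_H1(1)[OF u1]]] \<phi>])
    have "integral\<^sup>L (lebesgue_on \<Omega>) (\<lambda>x. \<Sum>j\<in>UNIV. u x $ j * partial_deriv j \<phi> x)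
        = (\<Sum>j\<in>UNIV. - integral\<^sup>L (lebesgue_on \<Omega>) (\<lambda>x. grad \<Omega> u x $ j $ j * \<phi> x))"
      using i1 grad_H1(2)[OF u1] \<phi> by (simp add: Bochner_Integration.integral_sum weak_gradient_def)
    also have "\<dots> = - integral\<^sup>L (lebesgue_on \<Omega>) (\<lambda>x. divergence \<Omega> u x * \<phi> x)"
      using i2 by (simp add: divergence_def trace_def sum_distrib_right Bochner_Integration.integral_sum sum_negf)
    also have "integral\<^sup>L (lebesgue_on \<Omega>) (\<lambda>x. divergence \<Omega> u x * \<phi> x) = 0"
      using V_h_divergence_free[OF assms] by (intro integral_eq_zero_AE) (auto elim: eventually_mono)
    finally show "integral\<^sup>L (lebesgue_on \<Omega>) (\<lambda>x. \<Sum>j\<in>UNIV. u x $ j * partial_deriv j \<phi> x) = 0" by simp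
  qed
  ultimately show ?thesis
    using H1_L2[OF u1] by (simp add: bounded_solenoidal_def L2_def)
qed

lemma bounded_solenoidal_scaleR:
  assumes "bounded_solenoidal \<Omega> u"
  shows "bounded_solenoidal \<Omega> (\<lambda>x. c *\<^sub>R u x)"
proof -
  obtain C where C: "C \<ge> 0" "\<forall>x\<in>\<Omega>. norm (u x) \<le> C" using assms by (auto simp: bounded_solenoidal_def)
  have "\<forall>x\<in>\<Omega>. norm (c *\<^sub>R u x) \<le> \<bar>c\<bar> * C" using C by (simp add: mult_left_mono)
  then have "\<exists>C\<ge>0. \<forall>x\<in>\<Omega>. norm (c *\<^sub>R u x) \<le> C" using C by (intro exI[of _ "\<bar>c\<bar> * C"]) auto
  moreover have "weakly_solenoidal \<Omega> (\<lambda>x. c *\<^sub>R u x)"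
    using assms
    by (simp add: bounded_solenoidal_def weakly_solenoidal_def mult.assoc flip: sum_distrib_left)
  moreover have "(\<lambda>x. c *\<^sub>R u x) \<in> borel_measurable (lebesgue_on \<Omega>)"
    using assms by (intro borel_measurable_scaleR) (auto simp: bounded_solenoidal_def)
  ultimately show ?thesis by (simp add: bounded_solenoidal_def)
qed

lemma bounded_solenoidal_add:
  assumes \<Omega>: "\<Omega> \<in> lmeasurable" and u: "bounded_solenoidal \<Omega> u" and v: "bounded_solenoidal \<Omega> v"
  shows "bounded_solenoidal \<Omega> (\<lambda>x. u x + v x)"
proof -
  obtain C D where C: "C \<ge> 0" "\<forall>x\<in>\<Omega>. norm (u x) \<le> C" and D: "D \<ge> 0" "\<forall>x\<in>\<Omega>. norm (v x) \<le> D"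
    using u v by (auto simp: bounded_solenoidal_def)
  have "\<forall>x\<in>\<Omega>. norm (u x + v x) \<le> C + D" using C D by (auto intro: norm_triangle_mono)
  then have bnd: "\<exists>C\<ge>0. \<forall>x\<in>\<Omega>. norm (u x + v x) \<le> C" using C D by (intro exI[of _ "C + D"]) auto
  have "L2 \<Omega> u" "L2 \<Omega> v"
    using C D u v by (auto intro!: L2_bounded[OF \<Omega>] simp: bounded_solenoidal_def)
  moreover have "integrable (lebesgue_on \<Omega>) (\<lambda>x. \<Sum>j\<in>UNIV. f x $ j * partial_deriv j \<phi> x)"
    if "L2 \<Omega> f" "test_function \<Omega> \<phi>" for f \<phi>
    using that
    by (intro Bochner_Integration.integrable_sum L2_mult_test_integrable[OF \<Omega>] L2_component
        test_function_partial)
  ultimately have "weakly_solenoidal \<Omega> (\<lambda>x. u x + v x)"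
    using u v by (simp add: bounded_solenoidal_def weakly_solenoidal_def distrib_right sum.distrib)
  then show ?thesis using u v bnd by (simp add: bounded_solenoidal_def borel_measurable_add)
qed

lemma bounded_solenoidal_sum:
  assumes \<Omega>: "\<Omega> \<in> lmeasurable" and "\<And>a. a \<in> A \<Longrightarrow> bounded_solenoidal \<Omega> (u a)"
  shows "bounded_solenoidal \<Omega> (\<lambda>x. \<Sum>a\<in>A. u a x)"
proof -
  have "bounded_solenoidal \<Omega> (\<lambda>x. 0)"
    by (auto simp: bounded_solenoidal_def weakly_solenoidal_def)
  then show ?thesis using assms(2)
    by (induction A rule: infinite_finite_induct) (auto intro: bounded_solenoidal_add[OF \<Omega>])
qed

lemma bounded_solenoidal_ens_mean:
  assumes "\<Omega> \<in> lmeasurable" "\<And>i. i \<in> {1..J} \<Longrightarrow> bounded_solenoidal \<Omega> (w i)"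
  shows "bounded_solenoidal \<Omega> (\<lambda>x. ens_mean J (\<lambda>i. w i x))"
  unfolding ens_mean_def using assms by (intro bounded_solenoidal_scaleR bounded_solenoidal_sum)

lemma bounded_solenoidal_ens_fluct:
  assumes "\<Omega> \<in> lmeasurable" "\<And>i. i \<in> {1..J} \<Longrightarrow> bounded_solenoidal \<Omega> (w i)" "j \<in> {1..J}"
  shows "bounded_solenoidal \<Omega> (\<lambda>x. ens_fluct J (\<lambda>i. w i x) j)"
  using bounded_solenoidal_add[OF assms(1) assms(2)[OF assms(3)]
      bounded_solenoidal_scaleR[OF bounded_solenoidal_ens_mean[OF assms(1,2)], where c = "-1"]]
  by (simp add: ens_fluct_def)


section \<open>The dual norm\<close>

lemma L2_norm_grad_ae_zero:
  assumes \<Omega>: "open \<Omega>" "bounded \<Omega>" and \<xi>: "ae_zero \<Omega> \<xi>"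
  shows "L2_norm \<Omega> (grad \<Omega> \<xi>) = 0"
proof -
  have Z: "L2 \<Omega> (\<lambda>x. 0 :: real^'a^'a)" by (simp add: L2_def)
  have "weak_gradient \<Omega> \<xi> (\<lambda>x. 0)"
    unfolding weak_gradient_def
  proof (intro allI impI)
    fix \<phi> and i j :: 'a
    have "AE x in lebesgue_on \<Omega>. \<xi> x $ i * partial_deriv j \<phi> x = 0"
      using \<xi> unfolding ae_zero_def by eventually_elim simp
    then show "integral\<^sup>L (lebesgue_on \<Omega>) (\<lambda>x. \<xi> x $ i * partial_deriv j \<phi> x)
        = - integral\<^sup>L (lebesgue_on \<Omega>) (\<lambda>x. (0 :: real^'a^'a) $ i $ j * \<phi> x)"
      by (simp add: integral_eq_zero_AE)
  qed
  from grad_AE_eq[OF \<Omega> Z this] have "L2_norm \<Omega> (grad \<Omega> \<xi>) = L2_norm \<Omega> (\<lambda>x. 0 :: real^'a^'a)"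
    using Z by (intro L2_norm_cong_AE)
  then show ?thesis by (simp add: L2_norm_def L2_inner_def)
qed

text \<open>
  The supremum runs over functions that are not almost everywhere zero.  If the gradient of \<open>\<xi>\<close> is not
  zero, then \<open>\<xi>\<close> is such a function, again by uniqueness of weak gradients; if it is zero, then the
  boundedness of \<open>F\<close> gives \<open>F \<xi> = 0\<close>.
\<close>

lemma Hm1_norm_bound:
  assumes \<Omega>: "open \<Omega>" "bounded \<Omega>" and F: "F \<in> Hm1 \<Omega>" and \<xi>: "\<xi> \<in> H10 \<Omega>"
  shows "F \<xi> \<le> Hm1_norm \<Omega> F * L2_norm \<Omega> (grad \<Omega> \<xi>)"
proof -
  have "\<exists>C. \<forall>\<xi>\<in>H10 \<Omega>. \<bar>F \<xi>\<bar> \<le> C * L2_norm \<Omega> (grad \<Omega> \<xi>)"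
    using F by (simp add: Hm1_def)
  then obtain C where "\<forall>\<xi>\<in>H10 \<Omega>. \<bar>F \<xi>\<bar> \<le> C * L2_norm \<Omega> (grad \<Omega> \<xi>)" ..
  note C = this[rule_format]
  show ?thesis
  proof (cases "L2_norm \<Omega> (grad \<Omega> \<xi>) = 0")
    case True
    then show ?thesis using C[OF \<xi>] by simp
  next
    case False
    then have pos: "L2_norm \<Omega> (grad \<Omega> \<xi>) > 0" using L2_norm_nonneg[of \<Omega> "grad \<Omega> \<xi>"] by linarith
    have "bdd_above ((\<lambda>\<xi>. F \<xi> / L2_norm \<Omega> (grad \<Omega> \<xi>)) ` {\<xi> \<in> H10 \<Omega>. \<not> ae_zero \<Omega> \<xi>})"
    proof (rule bdd_aboveI2)
      fix \<psi> assume "\<psi> \<in> {\<xi> \<in> H10 \<Omega>. \<not> ae_zero \<Omega> \<xi>}"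
      then have *: "F \<psi> \<le> C * L2_norm \<Omega> (grad \<Omega> \<psi>)" using C[of \<psi>] by simp
      show "F \<psi> / L2_norm \<Omega> (grad \<Omega> \<psi>) \<le> \<bar>C\<bar>"
      proof (cases "L2_norm \<Omega> (grad \<Omega> \<psi>) = 0")
        case False
        then have "L2_norm \<Omega> (grad \<Omega> \<psi>) > 0" using L2_norm_nonneg[of \<Omega> "grad \<Omega> \<psi>"] by linarith
        then have "F \<psi> / L2_norm \<Omega> (grad \<Omega> \<psi>) \<le> C" using * by (simp add: pos_divide_le_eq)
        then show ?thesis by linarith
      qed simp
    qed
    moreover have "\<not> ae_zero \<Omega> \<xi>" using L2_norm_grad_ae_zero[OF \<Omega>] False by blast
    ultimately have "F \<xi> / L2_norm \<Omega> (grad \<Omega> \<xi>) \<le> Hm1_norm \<Omega> F"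
      unfolding Hm1_norm_def using \<xi> by (intro cSUP_upper) auto
    then show ?thesis using pos by (simp add: pos_divide_le_eq)
  qed
qed

section \<open>The energy estimate\<close>

lemma Young_product:
  fixes a b e :: real
  assumes "e > 0"
  shows "a * b \<le> e / 2 * a\<^sup>2 + 1 / (2 * e) * b\<^sup>2"
proof -
  have "0 \<le> (e * a - b)\<^sup>2 / (2 * e)" using assms by simp
  also have "\<dots> = e / 2 * a\<^sup>2 + 1 / (2 * e) * b\<^sup>2 - a * b"
    using assms by (simp add: power2_eq_square field_simps)
  finally show ?thesis by simp
qed

lemma L2_inner_Young:
  fixes f g :: "real^'n \<Rightarrow> 'b::euclidean_space"
  assumes "L2 \<Omega> f" "L2 \<Omega> g" "e > 0"
  shows "\<bar>L2_inner \<Omega> f g\<bar> \<le> e / 2 * (L2_norm \<Omega> f)\<^sup>2 + 1 / (2 * e) * (L2_norm \<Omega> g)\<^sup>2"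
  using L2_Cauchy_Schwarz[OF assms(1,2)] Young_product[OF assms(3)] order_trans by blast

lemma trilinear_self_zero:
  assumes "open \<Omega>" "bounded \<Omega>" "bounded_solenoidal \<Omega> u" "v \<in> H10 \<Omega>"
  shows "trilinear \<Omega> u v v = 0"
proof -
  obtain C where "\<forall>x\<in>\<Omega>. norm (u x) \<le> C" using assms(3) by (auto simp: bounded_solenoidal_def)
  then have "trilinear \<Omega> u v v = - trilinear \<Omega> u v v"
    using assms by (intro trilinear_skew[where C = C]) (auto simp: bounded_solenoidal_def)
  then show ?thesis by linarith
qed

text \<open>
  By skew symmetry, \<open>- b(u, v, v') = b(u, v', v)\<close>, and subtracting \<open>b(u, v', v') = 0\<close> leaves
  \<open>b(u, v', v - v')\<close>: only the increment of \<open>v\<close> enters.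
\<close>

lemma lagged_convection_bound:
  assumes \<Omega>: "open \<Omega>" "bounded \<Omega>" and u: "bounded_solenoidal \<Omega> u"
    and v: "v \<in> H10 \<Omega>" and v': "v' \<in> H10 \<Omega>" and e: "e > 0"
  shows "- trilinear \<Omega> u v v' \<le> e / 2 * (L2_norm \<Omega> (\<lambda>x. grad \<Omega> v' x *v u x))\<^sup>2
    + 1 / (2 * e) * (L2_norm \<Omega> (\<lambda>x. v' x - v x))\<^sup>2"
proof -
  obtain C where C: "\<forall>x\<in>\<Omega>. norm (u x) \<le> C" "C \<ge> 0" and u': "u \<in> borel_measurable (lebesgue_on \<Omega>)"
    and sol: "weakly_solenoidal \<Omega> u"
    using u by (auto simp: bounded_solenoidal_def)
  have H1: "v \<in> H1 \<Omega>" "v' \<in> H1 \<Omega>" using v v' by (auto simp: H10_def)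
  note L = H1_L2[OF H1(1)] H1_L2[OF H1(2)]
  have Lu: "L2 \<Omega> (\<lambda>x. grad \<Omega> v' x *v u x)"
    using C by (intro L2_matrix_vector_mult(1)[OF grad_H1(1)[OF H1(2)] u', of C]) auto
  have "- trilinear \<Omega> u v v' = trilinear \<Omega> u v' v - trilinear \<Omega> u v' v'"
    using trilinear_skew[OF \<Omega> u' _ sol v v', of C] C trilinear_self_zero[OF \<Omega> u v'] by simp
  also have "\<dots> = - L2_inner \<Omega> (\<lambda>x. grad \<Omega> v' x *v u x) (\<lambda>x. v' x - v x)"
    unfolding trilinear_def using L Lu by (simp add: L2_inner_diff_right)
  also have "\<dots> \<le> e / 2 * (L2_norm \<Omega> (\<lambda>x. grad \<Omega> v' x *v u x))\<^sup>2
    + 1 / (2 * e) * (L2_norm \<Omega> (\<lambda>x. v' x - v x))\<^sup>2"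
    using L2_inner_Young[OF Lu L2_diff[OF L(2,1)] e] by linarith
  finally show ?thesis .
qed

lemma L2_inner_increment:
  fixes f g :: "real^'n \<Rightarrow> 'b::euclidean_space"
  assumes "L2 \<Omega> f" "L2 \<Omega> g"
  shows "L2_inner \<Omega> (\<lambda>x. f x - g x) f
    = ((L2_norm \<Omega> f)\<^sup>2 - (L2_norm \<Omega> g)\<^sup>2 + (L2_norm \<Omega> (\<lambda>x. f x - g x))\<^sup>2) / 2"
  using assms
  by (simp add: L2_norm_power2 L2_inner_diff_left L2_inner_diff_right L2_diff L2_inner_commute[of \<Omega> g f]
      field_simps)

text \<open>
  The eddy viscosity controls every fluctuation, since it is built from the largest of them.
\<close>

lemma eddy_viscosity_bound:
  fixes w :: "nat \<Rightarrow> real^'n \<Rightarrow> real^'n"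
  assumes G: "L2 \<Omega> G" and \<mu>: "\<mu> \<ge> 1 / 2" and dt: "\<Delta>t > 0" and j: "j \<in> {1..J}"
    and fl: "\<And>i. i \<in> {1..J} \<Longrightarrow> bounded_solenoidal \<Omega> (\<lambda>x. ens_fluct J (\<lambda>i. w i x) i)"
  shows "\<Delta>t * (L2_norm \<Omega> (\<lambda>x. G x *v ens_fluct J (\<lambda>i. w i x) j))\<^sup>2
    \<le> L2_inner \<Omega> (\<lambda>x. (2 * eddy_viscosity \<mu> \<Delta>t J w x) *\<^sub>R G x) G"
proof -
  define l where "l x = Max ((\<lambda>j. norm (ens_fluct J (\<lambda>i. w i x) j)) ` {1..J})" for x
  have meas: "(\<lambda>x. ens_fluct J (\<lambda>i. w i x) i) \<in> borel_measurable (lebesgue_on \<Omega>)" if "i \<in> {1..J}" for i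
    using fl[OF that] by (simp add: bounded_solenoidal_def)
  have l: "l \<in> borel_measurable (lebesgue_on \<Omega>)"
    unfolding l_def[abs_def] using meas by (intro borel_measurable_Max borel_measurable_norm) auto
  have le: "norm (ens_fluct J (\<lambda>i. w i x) i) \<le> l x" if "i \<in> {1..J}" for i x
    unfolding l_def using that by (intro Max_ge) auto
  have l0: "0 \<le> l x" for x using le[OF j] norm_ge_zero order_trans by blast
  have "\<exists>C\<ge>0. \<forall>x\<in>\<Omega>. norm (ens_fluct J (\<lambda>i. w i x) i) \<le> C" if "i \<in> {1..J}" for i
    using fl[OF that] by (simp add: bounded_solenoidal_def)
  then obtain C where C: "\<And>i. i \<in> {1..J} \<Longrightarrow> C i \<ge> 0"
    "\<And>i x. i \<in> {1..J} \<Longrightarrow> x \<in> \<Omega> \<Longrightarrow> norm (ens_fluct J (\<lambda>i. w i x) i) \<le> C i" by metis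
  (* The sum of the bounds of the members bounds their maximum. *)
  have lC: "l x \<le> (\<Sum>i\<in>{1..J}. C i)" if x: "x \<in> \<Omega>" for x
    unfolding l_def
  proof (subst Max_le_iff)
    show "\<forall>a\<in>(\<lambda>j. norm (ens_fluct J (\<lambda>i. w i x) j)) ` {1..J}. a \<le> sum C {1..J}"
    proof clarify
      fix i assume i: "i \<in> {1..J}"
      have "C i \<le> sum C {1..J}" using C(1) i by (intro member_le_sum) auto
      with C(2)[OF i x] show "norm (ens_fluct J (\<lambda>i. w i x) i) \<le> sum C {1..J}" by linarith
    qed
  qed (use j in auto)
  have Gm: "G \<in> borel_measurable (lebesgue_on \<Omega>)" using G by (simp add: L2_def)
  have LlG: "L2 \<Omega> (\<lambda>x. l x *\<^sub>R G x)"
  proof (rule L2_dominated(1)[OF G, where C = "\<Sum>i\<in>{1..J}. C i"])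
    show "(\<lambda>x. l x *\<^sub>R G x) \<in> borel_measurable (lebesgue_on \<Omega>)"
      using l Gm by (rule borel_measurable_scaleR)
    show "norm (l x *\<^sub>R G x) \<le> (\<Sum>i\<in>{1..J}. C i) * norm (G x)" if "x \<in> \<Omega>" for x
      using lC[OF that] l0[of x] by (simp add: mult_right_mono)
    show "0 \<le> (\<Sum>i\<in>{1..J}. C i)" using C(1) by (rule sum_nonneg)
  qed
  have "L2_norm \<Omega> (\<lambda>x. G x *v ens_fluct J (\<lambda>i. w i x) j) \<le> 1 * L2_norm \<Omega> (\<lambda>x. l x *\<^sub>R G x)"
  proof (rule L2_dominated(2)[OF LlG])
    show "(\<lambda>x. G x *v ens_fluct J (\<lambda>i. w i x) j) \<in> borel_measurable (lebesgue_on \<Omega>)"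
      using Gm meas[OF j] by (rule borel_measurable_matrix_vector_mult)
    fix x
    have "norm (G x *v ens_fluct J (\<lambda>i. w i x) j) \<le> norm (G x) * norm (ens_fluct J (\<lambda>i. w i x) j)"
      by (rule norm_matrix_vector_mult_le)
    also have "\<dots> \<le> norm (G x) * l x" using le[OF j] by (intro mult_left_mono) auto
    finally show "norm (G x *v ens_fluct J (\<lambda>i. w i x) j) \<le> 1 * norm (l x *\<^sub>R G x)"
      using l0[of x] by (simp add: mult.commute)
  qed simp
  then have "(L2_norm \<Omega> (\<lambda>x. G x *v ens_fluct J (\<lambda>i. w i x) j))\<^sup>2 \<le> (L2_norm \<Omega> (\<lambda>x. l x *\<^sub>R G x))\<^sup>2"
    by (intro power_mono) auto
  then have "\<Delta>t * (L2_norm \<Omega> (\<lambda>x. G x *v ens_fluct J (\<lambda>i. w i x) j))\<^sup>2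
      \<le> (2 * \<mu> * \<Delta>t) * (L2_norm \<Omega> (\<lambda>x. l x *\<^sub>R G x))\<^sup>2"
    using \<mu> dt by (intro mult_mono) auto
  also have "\<dots> = L2_inner \<Omega> (\<lambda>x. (2 * eddy_viscosity \<mu> \<Delta>t J w x) *\<^sub>R G x) G"
  proof -
    have "(2 * \<mu> * \<Delta>t) * ((l x *\<^sub>R G x) \<bullet> (l x *\<^sub>R G x))
        = (2 * eddy_viscosity \<mu> \<Delta>t J w x) *\<^sub>R G x \<bullet> G x" for x
      by (simp add: eddy_viscosity_def l_def power2_eq_square)
    then show ?thesis
      unfolding L2_norm_power2 L2_inner_def integral_mult_right_zero[symmetric] by (simp only:)
  qed
  finally show ?thesis .
qed

text \<open>
  The equation is tested with \<open>v'\<close>.  The square of the increment \<open>v' - v j\<close> that the difference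
  quotient produces cancels against the one from \<open>lagged_convection_bound\<close> with \<open>e = \<Delta>t\<close>.
\<close>

lemma scheme_energy_inequality:
  fixes v w :: "nat \<Rightarrow> real^'n \<Rightarrow> real^'n"
  assumes \<Omega>: "open \<Omega>" "bounded \<Omega>" and \<mu>: "\<mu> \<ge> 1 / 2" and dt: "\<Delta>t > 0" and j: "j \<in> {1..J}"
    and V: "\<And>u. u \<in> V \<Longrightarrow> u \<in> H10 \<Omega> \<and> bounded_solenoidal \<Omega> u"
    and v: "v j \<in> V" and w: "\<And>i. i \<in> {1..J} \<Longrightarrow> w i \<in> V" and v': "v' \<in> V"
    and eq: "scheme_eq \<Omega> V \<mu> \<Delta>t J \<nu> \<nu>\<^sub>m F v w j v'"
  shows "((L2_norm \<Omega> v')\<^sup>2 - (L2_norm \<Omega> (v j))\<^sup>2) / (2 * \<Delta>t)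
      + (ens_mean J \<nu> + ens_mean J \<nu>\<^sub>m) / 2 * (L2_norm \<Omega> (grad \<Omega> v'))\<^sup>2
    \<le> F v'
      + \<bar>\<nu> j - \<nu>\<^sub>m j\<bar> / 4 * ((L2_norm \<Omega> (grad \<Omega> (w j)))\<^sup>2 + (L2_norm \<Omega> (grad \<Omega> v'))\<^sup>2)
      + \<bar>ens_fluct J \<nu> j + ens_fluct J \<nu>\<^sub>m j\<bar> / 4 *
          ((L2_norm \<Omega> (grad \<Omega> (v j)))\<^sup>2 + (L2_norm \<Omega> (grad \<Omega> v'))\<^sup>2)"
proof -
  have lm: "\<Omega> \<in> lmeasurable" using \<Omega> by (simp add: lmeasurable_open)
  have H1: "u \<in> H1 \<Omega>" if "u \<in> V" for u using V[OF that] by (simp add: H10_def)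
  have bs: "bounded_solenoidal \<Omega> (w i)" if "i \<in> {1..J}" for i using V w that by blast
  note fl = bounded_solenoidal_ens_fluct[OF lm bs]
  note gL = grad_H1(1)[OF H1]
  let ?d = "\<lambda>x. v' x - v j x" and ?b = "ens_fluct J \<nu> j + ens_fluct J \<nu>\<^sub>m j" and ?a = "\<nu> j - \<nu>\<^sub>m j"
  let ?S = "(L2_norm \<Omega> (\<lambda>x. grad \<Omega> v' x *v ens_fluct J (\<lambda>i. w i x) j))\<^sup>2"
  have "L2_inner \<Omega> (\<lambda>x. (1 / \<Delta>t) *\<^sub>R ?d x) v'
      = ((L2_norm \<Omega> v')\<^sup>2 - (L2_norm \<Omega> (v j))\<^sup>2) / (2 * \<Delta>t) + 1 / (2 * \<Delta>t) * (L2_norm \<Omega> ?d)\<^sup>2"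
    unfolding L2_inner_scaleR_left L2_inner_increment[OF H1_L2[OF H1[OF v']] H1_L2[OF H1[OF v]]]
    using dt by (simp add: field_simps)
  moreover have "trilinear \<Omega> (\<lambda>x. ens_mean J (\<lambda>i. w i x)) v' v' = 0"
    using V v' by (intro trilinear_self_zero[OF \<Omega>] bounded_solenoidal_ens_mean[OF lm bs]) auto
  moreover have "\<Delta>t * ?S
      \<le> L2_inner \<Omega> (\<lambda>x. (2 * eddy_viscosity \<mu> \<Delta>t J w x) *\<^sub>R grad \<Omega> v' x) (grad \<Omega> v')"
    by (rule eddy_viscosity_bound[OF gL[OF v'] \<mu> dt j fl])
  moreover have "- trilinear \<Omega> (\<lambda>x. ens_fluct J (\<lambda>i. w i x) j) (v j) v'
      \<le> \<Delta>t / 2 * ?S + 1 / (2 * \<Delta>t) * (L2_norm \<Omega> ?d)\<^sup>2"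
    using V[OF v] V[OF v'] by (intro lagged_convection_bound[OF \<Omega> fl[OF _ j] _ _ dt]) auto
  moreover have "0 \<le> \<Delta>t * ?S" using dt by simp
  moreover have cross: "- (c / 2 * L2_inner \<Omega> (grad \<Omega> u) (grad \<Omega> v'))
      \<le> \<bar>c\<bar> / 4 * ((L2_norm \<Omega> (grad \<Omega> u))\<^sup>2 + (L2_norm \<Omega> (grad \<Omega> v'))\<^sup>2)" if u: "u \<in> V" for c u
  proof -
    have "- (c / 2 * L2_inner \<Omega> (grad \<Omega> u) (grad \<Omega> v')) \<le> \<bar>c\<bar> / 2 * \<bar>L2_inner \<Omega> (grad \<Omega> u) (grad \<Omega> v')\<bar>"
      using abs_ge_minus_self[of "c / 2 * L2_inner \<Omega> (grad \<Omega> u) (grad \<Omega> v')"] by (simp add: abs_mult)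
    also have "\<dots> \<le> \<bar>c\<bar> / 2 * (1 / 2 * (L2_norm \<Omega> (grad \<Omega> u))\<^sup>2 + 1 / (2 * 1) * (L2_norm \<Omega> (grad \<Omega> v'))\<^sup>2)"
      by (intro mult_left_mono L2_inner_Young gL u v') auto
    finally show ?thesis by (simp add: algebra_simps)
  qed
  note cross[OF w[OF j], of ?a] cross[OF v, of ?b]
  moreover note eq[unfolded scheme_eq_def, rule_format, OF v']
  ultimately show ?thesis unfolding L2_norm_power2[of \<Omega> "grad \<Omega> v'"] by linarith
qed

text \<open>
  The bookkeeping of one time step.  Here \<open>v\<close>, \<open>w\<close> stand for squared norms, \<open>gv\<close>, \<open>gw\<close> for squared
  norms of gradients, \<open>f\<close>, \<open>g\<close> for the values of the forcing at the new solution, \<open>nf\<close>, \<open>ng\<close> for its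
  squared dual norms, primes mark the new level, and \<open>N\<close> is the sum of the two mean viscosities.  After
  multiplication by \<open>2 dt\<close> the viscosity supplies \<open>N dt\<close> times the new gradient energy.  The cross
  terms consume \<open>a + b = N - \<alpha>\<close>, half of it at each of the two levels, and the forcing consumes
  \<open>\<alpha> / 2\<close> at the new level.  What remains at the new level is \<open>N / 2\<close>, while the old level owes
  \<open>N / 2 - \<alpha> / 2\<close>: the terms with \<open>N / 2\<close> telescope, the one with \<open>\<alpha> / 2\<close> is the dissipation.
\<close>

lemma energy_step_arith:
  fixes N \<alpha> a b dt :: real
  assumes \<alpha>: "\<alpha> = N - a - b" "\<alpha> > 0" and dt: "dt > 0"
    and v: "(v' - v) / (2 * dt) + N / 2 * gv' \<le> f + a / 4 * (gw + gv') + b / 4 * (gv + gv')"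
    and w: "(w' - w) / (2 * dt) + N / 2 * gw' \<le> g + a / 4 * (gv + gw') + b / 4 * (gw + gw')"
    and f: "f \<le> 1 / \<alpha> * nf + \<alpha> / 4 * gv'" and g: "g \<le> 1 / \<alpha> * ng + \<alpha> / 4 * gw'"
  shows "v' + w' + N / 2 * dt * (gv' + gw') + \<alpha> * dt / 2 * (gv + gw)
    \<le> v + w + N / 2 * dt * (gv + gw) + 2 * dt / \<alpha> * (nf + ng)"
proof -
  define P Q r where "P = (v' - v) / (2 * dt)" and "Q = (w' - w) / (2 * dt)" and "r = 1 / \<alpha>"
  have "P + Q + N / 4 * (gv' + gw') + \<alpha> / 4 * (gv + gw) \<le> N / 4 * (gv + gw) + r * (nf + ng)"
    using v w f g
    unfolding P_def[symmetric] Q_def[symmetric] r_def[symmetric] unfolding \<alpha>(1)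
    by (simp add: algebra_simps diff_divide_distrib add_divide_distrib)
  then have "2 * dt * (P + Q + N / 4 * (gv' + gw') + \<alpha> / 4 * (gv + gw))
      \<le> 2 * dt * (N / 4 * (gv + gw) + r * (nf + ng))"
    using dt by (intro mult_left_mono) auto
  moreover have "2 * dt * P = v' - v" "2 * dt * Q = w' - w" "2 * dt / \<alpha> = 2 * dt * r"
    using dt by (simp_all add: P_def Q_def r_def)
  ultimately show ?thesis by (simp add: algebra_simps add_divide_distrib)
qed

lemma telescoping_bound:
  fixes E D F :: "nat \<Rightarrow> real"
  assumes "\<And>n. n < M \<Longrightarrow> E (Suc n) + a * D n \<le> E n + c * F n"
  shows "E M + a * (\<Sum>n<M. D n) \<le> E 0 + c * (\<Sum>n<M. F n)"
  using assms
proof (induction M)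
  case (Suc M)
  have "E M + a * (\<Sum>n<M. D n) \<le> E 0 + c * (\<Sum>n<M. F n)" using Suc by simp
  with Suc.prems[of M] show ?case by (simp add: distrib_left)
qed simp

theorem theorem3p1:
  fixes \<Omega> :: "(real^'n) set" and \<T> :: "(real^'n) set set" and h \<beta> :: real and k :: nat
    and J M :: nat and T \<Delta>t \<mu> :: real and \<nu> \<nu>\<^sub>m :: "nat \<Rightarrow> real"
    and f\<^sub>1 f\<^sub>2 :: "nat \<Rightarrow> real \<Rightarrow> (real^'n \<Rightarrow> real^'n) \<Rightarrow> real"
    and v w :: "nat \<Rightarrow> nat \<Rightarrow> real^'n \<Rightarrow> real^'n"
  assumes "CARD('n) \<in> {2, 3}"
    and "convex_polytopal_domain \<Omega>"
    and "mesh \<Omega> \<T>" and "h = Max (diameter ` \<T>)"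
    and "k \<ge> 1" and "inf_sup \<Omega> \<T> k \<beta>"
    and "J \<ge> 1" and "\<And>j. j \<in> {1..J} \<Longrightarrow> \<nu> j > 0" and "\<And>j. j \<in> {1..J} \<Longrightarrow> \<nu>\<^sub>m j > 0"
    and "T > 0" and "M \<ge> 1" and "\<Delta>t = T / real M"
    and "\<And>j. j \<in> {1..J} \<Longrightarrow> Linf_Hm1 T \<Omega> (f\<^sub>1 j)"
    and "\<And>j. j \<in> {1..J} \<Longrightarrow> Linf_Hm1 T \<Omega> (f\<^sub>2 j)"
    and "\<And>j n. j \<in> {1..J} \<Longrightarrow> n \<in> {1..M} \<Longrightarrow> f\<^sub>1 j (real n * \<Delta>t) \<in> Hm1 \<Omega>"
    and "\<And>j n. j \<in> {1..J} \<Longrightarrow> n \<in> {1..M} \<Longrightarrow> f\<^sub>2 j (real n * \<Delta>t) \<in> Hm1 \<Omega>"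
    and "\<And>j. j \<in> {1..J} \<Longrightarrow> v 0 j \<in> V_h \<Omega> \<T> k"
    and "\<And>j. j \<in> {1..J} \<Longrightarrow> w 0 j \<in> V_h \<Omega> \<T> k"
    and "\<And>j. j \<in> {1..J} \<Longrightarrow> alpha J \<nu> \<nu>\<^sub>m j > 0"
    and "\<mu> > 1 / 2"
    and "ensemble_solution \<Omega> (V_h \<Omega> \<T> k) \<mu> \<Delta>t M J \<nu> \<nu>\<^sub>m f\<^sub>1 f\<^sub>2 v w"
  shows "\<forall>j\<in>{1..J}.
    (L2_norm \<Omega> (v M j))\<^sup>2 + (L2_norm \<Omega> (w M j))\<^sup>2
    + (ens_mean J \<nu> + ens_mean J \<nu>\<^sub>m) / 2 * \<Delta>t *
        ((L2_norm \<Omega> (grad \<Omega> (v M j)))\<^sup>2 + (L2_norm \<Omega> (grad \<Omega> (w M j)))\<^sup>2)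
    + alpha J \<nu> \<nu>\<^sub>m j * \<Delta>t / 2 *
        (\<Sum>n<M. (L2_norm \<Omega> (grad \<Omega> (v n j)))\<^sup>2 + (L2_norm \<Omega> (grad \<Omega> (w n j)))\<^sup>2)
    \<le> (L2_norm \<Omega> (v 0 j))\<^sup>2 + (L2_norm \<Omega> (w 0 j))\<^sup>2
    + (ens_mean J \<nu> + ens_mean J \<nu>\<^sub>m) / 2 * \<Delta>t *
        ((L2_norm \<Omega> (grad \<Omega> (v 0 j)))\<^sup>2 + (L2_norm \<Omega> (grad \<Omega> (w 0 j)))\<^sup>2)
    + 2 * \<Delta>t / alpha J \<nu> \<nu>\<^sub>m j *
        (\<Sum>n<M. (Hm1_norm \<Omega> (f\<^sub>1 j (real (Suc n) * \<Delta>t)))\<^sup>2 + (Hm1_norm \<Omega> (f\<^sub>2 j (real (Suc n) * \<Delta>t)))\<^sup>2)"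
proof
  fix j assume j: "j \<in> {1..J}"
  let ?V = "V_h \<Omega> \<T> k" and ?\<alpha> = "alpha J \<nu> \<nu>\<^sub>m j"
  have \<Omega>: "open \<Omega>" "bounded \<Omega>" using assms(2) by (auto simp: convex_polytopal_domain_def)
  have dt: "\<Delta>t > 0" using assms(10-12) by simp
  have \<mu>: "\<mu> \<ge> 1 / 2" using assms(20) by simp
  have \<alpha>: "?\<alpha> > 0" using assms(19)[OF j] .
  have V: "u \<in> H10 \<Omega> \<and> bounded_solenoidal \<Omega> u" if "u \<in> ?V" for u
    using V_h_H10[OF that] V_h_bounded_solenoidal[OF assms(2,3,5) that] ..
  note sol = assms(21)[unfolded ensemble_solution_def, rule_format]
  have inV: "v n i \<in> ?V" "w n i \<in> ?V" if "n \<le> M" "i \<in> {1..J}" for n i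
    using that assms(17,18) sol by (cases n; simp)+
  have force: "F u \<le> 1 / ?\<alpha> * (Hm1_norm \<Omega> F)\<^sup>2 + ?\<alpha> / 4 * (L2_norm \<Omega> (grad \<Omega> u))\<^sup>2"
    if "F \<in> Hm1 \<Omega>" "u \<in> ?V" for F u
  proof -
    have "F u \<le> Hm1_norm \<Omega> F * L2_norm \<Omega> (grad \<Omega> u)"
      using V[OF that(2)] by (intro Hm1_norm_bound[OF \<Omega> that(1)]) simp
    (* The weight 2 / alpha leaves alpha / 4 for the gradient, as the bookkeeping requires. *)
    also have "\<dots> \<le> (2 / ?\<alpha>) / 2 * (Hm1_norm \<Omega> F)\<^sup>2 + 1 / (2 * (2 / ?\<alpha>)) * (L2_norm \<Omega> (grad \<Omega> u))\<^sup>2"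
      using \<alpha> by (intro Young_product) simp
    finally show ?thesis by simp
  qed
  let ?E = "\<lambda>n. (L2_norm \<Omega> (v n j))\<^sup>2 + (L2_norm \<Omega> (w n j))\<^sup>2
    + (ens_mean J \<nu> + ens_mean J \<nu>\<^sub>m) / 2 * \<Delta>t *
        ((L2_norm \<Omega> (grad \<Omega> (v n j)))\<^sup>2 + (L2_norm \<Omega> (grad \<Omega> (w n j)))\<^sup>2)"
  show "?E M + ?\<alpha> * \<Delta>t / 2 * (\<Sum>n<M. (L2_norm \<Omega> (grad \<Omega> (v n j)))\<^sup>2 + (L2_norm \<Omega> (grad \<Omega> (w n j)))\<^sup>2)
    \<le> ?E 0 + 2 * \<Delta>t / ?\<alpha> * (\<Sum>n<M. (Hm1_norm \<Omega> (f\<^sub>1 j (real (Suc n) * \<Delta>t)))\<^sup>2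
        + (Hm1_norm \<Omega> (f\<^sub>2 j (real (Suc n) * \<Delta>t)))\<^sup>2)"
  proof (rule telescoping_bound)
    fix n assume n: "n < M"
    have f: "f\<^sub>1 j (real (Suc n) * \<Delta>t) \<in> Hm1 \<Omega>" "f\<^sub>2 j (real (Suc n) * \<Delta>t) \<in> Hm1 \<Omega>"
      using assms(15,16) j n by (metis Suc_leI atLeastAtMost_iff le_add1 plus_1_eq_Suc)+
    note s = sol[OF n j]
    have old: "v n i \<in> ?V" "w n i \<in> ?V" if "i \<in> {1..J}" for i using inV n that by simp_all
    have new: "v (Suc n) j \<in> ?V" "w (Suc n) j \<in> ?V" using s by auto
    note eqs = s[THEN conjunct2, THEN conjunct1] s[THEN conjunct2, THEN conjunct2, THEN conjunct2]
    show "?E (Suc n) + ?\<alpha> * \<Delta>t / 2 * ((L2_norm \<Omega> (grad \<Omega> (v n j)))\<^sup>2 + (L2_norm \<Omega> (grad \<Omega> (w n j)))\<^sup>2)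
      \<le> ?E n + 2 * \<Delta>t / ?\<alpha> * ((Hm1_norm \<Omega> (f\<^sub>1 j (real (Suc n) * \<Delta>t)))\<^sup>2
        + (Hm1_norm \<Omega> (f\<^sub>2 j (real (Suc n) * \<Delta>t)))\<^sup>2)"
    proof (rule energy_step_arith)
      show "?\<alpha> = ens_mean J \<nu> + ens_mean J \<nu>\<^sub>m - \<bar>\<nu> j - \<nu>\<^sub>m j\<bar> - \<bar>ens_fluct J \<nu> j + ens_fluct J \<nu>\<^sub>m j\<bar>"
        by (rule alpha_def)
      show "((L2_norm \<Omega> (v (Suc n) j))\<^sup>2 - (L2_norm \<Omega> (v n j))\<^sup>2) / (2 * \<Delta>t)
          + (ens_mean J \<nu> + ens_mean J \<nu>\<^sub>m) / 2 * (L2_norm \<Omega> (grad \<Omega> (v (Suc n) j)))\<^sup>2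
        \<le> f\<^sub>1 j (real (Suc n) * \<Delta>t) (v (Suc n) j)
          + \<bar>\<nu> j - \<nu>\<^sub>m j\<bar> / 4 * ((L2_norm \<Omega> (grad \<Omega> (w n j)))\<^sup>2 + (L2_norm \<Omega> (grad \<Omega> (v (Suc n) j)))\<^sup>2)
          + \<bar>ens_fluct J \<nu> j + ens_fluct J \<nu>\<^sub>m j\<bar> / 4 *
              ((L2_norm \<Omega> (grad \<Omega> (v n j)))\<^sup>2 + (L2_norm \<Omega> (grad \<Omega> (v (Suc n) j)))\<^sup>2)"
        by (rule scheme_energy_inequality[OF \<Omega> \<mu> dt j V old(1)[OF j] old(2) new(1) eqs(1)])
      show "((L2_norm \<Omega> (w (Suc n) j))\<^sup>2 - (L2_norm \<Omega> (w n j))\<^sup>2) / (2 * \<Delta>t)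
          + (ens_mean J \<nu> + ens_mean J \<nu>\<^sub>m) / 2 * (L2_norm \<Omega> (grad \<Omega> (w (Suc n) j)))\<^sup>2
        \<le> f\<^sub>2 j (real (Suc n) * \<Delta>t) (w (Suc n) j)
          + \<bar>\<nu> j - \<nu>\<^sub>m j\<bar> / 4 * ((L2_norm \<Omega> (grad \<Omega> (v n j)))\<^sup>2 + (L2_norm \<Omega> (grad \<Omega> (w (Suc n) j)))\<^sup>2)
          + \<bar>ens_fluct J \<nu> j + ens_fluct J \<nu>\<^sub>m j\<bar> / 4 *
              ((L2_norm \<Omega> (grad \<Omega> (w n j)))\<^sup>2 + (L2_norm \<Omega> (grad \<Omega> (w (Suc n) j)))\<^sup>2)"
        by (rule scheme_energy_inequality[OF \<Omega> \<mu> dt j V old(2)[OF j] old(1) new(2) eqs(2)])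
    qed (rule \<alpha> dt force[OF f(1) new(1)] force[OF f(2) new(2)])+
  qed
qed


end
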